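(* Consider the Gaussian white noise model with the Poisson–Gaussian sieve prior $\Pi$ described in the context. Let $L_0>0$, $\beta_2\ge\beta_1>1/2$, let $\epsilon_n(\beta)=\epsilon_0(\log n/n)^{\beta/(2\beta+1)}$ for a suitable constant $\epsilon_0>0$ not depending on $\beta$, and $j_n=\lfloor j_0n\epsilon_n^2(\beta)/\log n\rfloor$ with $j_0>0$. Suppose that, for some $m\ge5$, for $n$ large enough there exists a positive constant $C_0$ such that for all $\beta\in[\beta_1,\beta_2]$ and all $\boldsymbol\theta_0\in\Theta_\beta(L_0)$, $$K\big(p_0^{(n)},p_{0j_n}^{(n)}\big)\le C_0\,n\,\|\boldsymbol\theta_0-\boldsymbol\theta_{0j_n}\|_2^2\quad\text{and}\quad V_{m,0}\big(p_0^{(n)},p_{0j_n}^{(n)}\big)\le C_0^m\,n^{m/2}\,\|\boldsymbol\theta_0-\boldsymbol\theta_{0j_n}\|_2^m .$$ Then, for any $\beta\in[\beta_1,\beta_2]$ and any $\boldsymbol\theta_0\in\Theta_\beta(L_0)$, the expected posterior risk given $\boldsymbol\theta_0$ and $\Pi$ converges at least at the rate $\epsilon_n=\epsilon_n(\beta)$: $$\mathcal{R}_n^{L^2}(\boldsymbol\theta_0)=\mathbb{E}_0^{(n)}\,\Pi\big[\|\boldsymbol\theta-\boldsymbol\theta_0\|_2^2\,\big|\,X^n\big]=\mathcal{O}(\epsilon_n^2).$$ So the procedure (whose prior does not depend on $\beta$) is risk adaptive as well, up to a $\log n$ term.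
   Context: White noise model (sequence form). One observes $X^n=(X_j^n)_{j\ge1}$ with $X_j^n=\theta_{0j}+\frac{1}{\sqrt n}\xi_j$, $j=1,2,\ldots$, where the $\xi_j$ are independent standard Gaussian variables and $\boldsymbol\theta_0=(\theta_{0j})_{j\ge1}\in l^2$ is unknown. (Equivalently $dX^n(t)=\boldsymbol f_0(t)dt+n^{-1/2}dW(t)$ on $[0,1]$, with $\theta_{0j}$ the Fourier coefficients of $\boldsymbol f_0\in L^2(0,1)$.) $\mathbb{E}_0^{(n)}$ is the expectation under $\boldsymbol\theta_0$; $\|\cdot\|_2$ is the $l^2$ norm. $p_{\boldsymbol\theta}^{(n)}$ is the density of the law of the observations under $\boldsymbol\theta$ with respect to a dominating measure $\mu$, $p_0^{(n)}=p_{\boldsymbol\theta_0}^{(n)}$, $\boldsymbol\theta_{0k}$ is the projection of $\boldsymbol\theta_0$ on its first $k$ coordinates (other entries $0$), and $p_{0k}^{(n)}$ is the density at $\boldsymbol\theta_{0k}$. Divergences. $K(f,g)=\int f\log(f/g)d\mu$, $V_{m,0}(f,g)=\int f|\log(f/g)-K(f,g)|^md\mu$. Sobolev classes. $\Theta_\beta(L_0)=\{\boldsymbol\theta:\sum_{j\ge1}\theta_j^2j^{2\beta}<L_0\}$, $\beta>1/2$, $L_0>0$. Prior $\Pi$. $k\sim\mathrm{Poisson}(\lambda)$ with fixed $\lambda>0$; given $k$, the variables $\theta_j/\tau_j$, $j=1,\ldots,k$, are independent $\mathcal{N}(0,1)$ and $\theta_j=0$ for $j>k$; the scales are $\tau_j^2=\tau_0j^{-2q}$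 with $\tau_0>0$ and $1/2<q\le1$. $\Pi(\cdot|X^n)$ denotes posterior probability or expectation. *)

theory Defs
  imports "HOL-Probability.Probability"
begin

(* A sequence (a_j) indexed by j = 1, 2, ... is a function a :: nat => real whose value at i is
   the coordinate with index j = i + 1. *)

abbreviation seq_borel :: "(nat \<Rightarrow> real) measure" where
  "seq_borel \<equiv> PiM UNIV (\<lambda>_. borel)"

definition l2 :: "(nat \<Rightarrow> real) set" where
  "l2 = {\<theta>. summable (\<lambda>i. (\<theta> i)\<^sup>2)}"

definition l2_norm :: "(nat \<Rightarrow> real) \<Rightarrow> real" where
  "l2_norm \<theta> = sqrt (\<Sum>i. (\<theta> i)\<^sup>2)"

definition first_coords :: "nat \<Rightarrow> (nat \<Rightarrow> real) \<Rightarrow> nat \<Rightarrow> real" where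
  "first_coords k \<theta> = (\<lambda>i. if i < k then \<theta> i else 0)"

definition sobolev_class :: "real \<Rightarrow> real \<Rightarrow> (nat \<Rightarrow> real) set" where
  "sobolev_class \<beta> L =
     {\<theta>. summable (\<lambda>i. (\<theta> i)\<^sup>2 * real (Suc i) powr (2 * \<beta>)) \<and>
         (\<Sum>i. (\<theta> i)\<^sup>2 * real (Suc i) powr (2 * \<beta>)) < L}"

definition std_noise :: "(nat \<Rightarrow> real) measure" where
  "std_noise = PiM UNIV (\<lambda>_. density lborel std_normal_density)"

definition wn_law :: "nat \<Rightarrow> (nat \<Rightarrow> real) \<Rightarrow> (nat \<Rightarrow> real) measure" where
  "wn_law n \<theta> = distr std_noise seq_borel (\<lambda>\<xi> i. \<theta> i + \<xi> i / sqrt (real n))"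

(* p \<theta> is a density of the law of the observations under \<theta> with respect to \<mu>. Joint
   measurability is what makes Bayes' formula meaningful; different versions of p give the same
   posterior outside a set of observations that is null under every wn_law n \<theta>, \<theta> in l2. *)
definition wn_densities ::
  "nat \<Rightarrow> (nat \<Rightarrow> real) measure \<Rightarrow> ((nat \<Rightarrow> real) \<Rightarrow> (nat \<Rightarrow> real) \<Rightarrow> real) \<Rightarrow> bool" where
  "wn_densities n \<mu> p \<longleftrightarrow>
     sigma_finite_measure \<mu> \<and> sets \<mu> = sets seq_borel \<and>
     (\<lambda>(\<theta>, x). p \<theta> x) \<in> borel_measurable (seq_borel \<Otimes>\<^sub>M seq_borel) \<and>
     (\<forall>\<theta> x. 0 \<le> p \<theta> x) \<and>
     (\<forall>\<theta>\<in>l2. density \<mu> (\<lambda>x. ennreal (p \<theta> x)) = wn_law n \<theta>)"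

definition K_div :: "'a measure \<Rightarrow> ('a \<Rightarrow> real) \<Rightarrow> ('a \<Rightarrow> real) \<Rightarrow> real" where
  "K_div \<mu> f g = (\<integral>x. f x * ln (f x / g x) \<partial>\<mu>)"

(* Extended-valued, so that an upper bound on it contains the finiteness of the integral. For
   probability densities f, g and m \<ge> 1, finiteness also forces f * ln (f / g) to be integrable,
   hence the value 0 of a divergent Bochner integral K_div never matters under such a bound. *)
definition V_div :: "'a measure \<Rightarrow> real \<Rightarrow> ('a \<Rightarrow> real) \<Rightarrow> ('a \<Rightarrow> real) \<Rightarrow> ennreal" where
  "V_div \<mu> m f g = (\<integral>\<^sup>+x. ennreal (f x * \<bar>ln (f x / g x) - K_div \<mu> f g\<bar> powr m) \<partial>\<mu>)"

(* \<tau>0 is the factor in \<tau>_j^2 = \<tau>0 * j^(-2q). *)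
definition prior_scale :: "real \<Rightarrow> real \<Rightarrow> nat \<Rightarrow> real" where
  "prior_scale \<tau>0 q i = sqrt (\<tau>0 * real (Suc i) powr (- 2 * q))"

definition sieve_prior :: "real \<Rightarrow> real \<Rightarrow> real \<Rightarrow> (nat \<Rightarrow> real) measure" where
  "sieve_prior lam \<tau>0 q =
     distr (measure_pmf (poisson_pmf lam) \<Otimes>\<^sub>M std_noise) seq_borel
       (\<lambda>(k, z) i. if i < k then prior_scale \<tau>0 q i * z i else 0)"

definition posterior ::
  "'b measure \<Rightarrow> ('b \<Rightarrow> 'a \<Rightarrow> real) \<Rightarrow> 'a \<Rightarrow> 'b measure" where
  "posterior \<pi> p x =
     density \<pi> (\<lambda>\<theta>. ennreal (p \<theta> x) / (\<integral>\<^sup>+\<theta>'. ennreal (p \<theta>' x) \<partial>\<pi>))"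

definition posterior_risk ::
  "(nat \<Rightarrow> real) measure \<Rightarrow> nat \<Rightarrow> ((nat \<Rightarrow> real) \<Rightarrow> (nat \<Rightarrow> real) \<Rightarrow> real) \<Rightarrow>
   (nat \<Rightarrow> real) \<Rightarrow> ennreal" where
  "posterior_risk \<pi> n p \<theta>0 =
     (\<integral>\<^sup>+x. (\<integral>\<^sup>+\<theta>. ennreal ((l2_norm (\<theta> - \<theta>0))\<^sup>2) \<partial>posterior \<pi> p x) \<partial>wn_law n \<theta>0)"

definition rate :: "real \<Rightarrow> real \<Rightarrow> nat \<Rightarrow> real" where
  "rate \<epsilon>0 \<beta> n = \<epsilon>0 * (ln (real n) / real n) powr (\<beta> / (2 * \<beta> + 1))"

definition cutoff :: "real \<Rightarrow> real \<Rightarrow> real \<Rightarrow> nat \<Rightarrow> nat" where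
  "cutoff j0 \<epsilon>0 \<beta> n = nat \<lfloor>j0 * real n * (rate \<epsilon>0 \<beta> n)\<^sup>2 / ln (real n)\<rfloor>"

end

theory Submission
  imports Defs "HOL-Real_Asymp.Real_Asymp"
begin

text \<open>
  Given the dimension \<open>k\<close>, prior and likelihood are conjugate, so the posterior is explicit. With
  \<open>t\<^sub>i = n s\<^sub>i\<^sup>2\<close>, where \<open>s\<^sub>i\<close> is the prior standard deviation of coordinate \<open>i\<close>, and
  \<open>a\<^sub>i = t\<^sub>i / (1 + t\<^sub>i)\<close>, the posterior of \<open>\<theta>\<^sub>i\<close> (for \<open>i < k\<close>) is normal with mean \<open>a\<^sub>i x\<^sub>i\<close> and
  variance \<open>a\<^sub>i / n\<close>, and the posterior weight \<open>W\<^sub>k\<close> of dimension \<open>k\<close> is proportional to the prior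
  weight times the product over \<open>i < k\<close> of the Bayes factors
  \<open>(1 + t\<^sub>i) powr (-1/2) * exp (a\<^sub>i n x\<^sub>i\<^sup>2 / 2)\<close>. Lemma \<open>posterior_risk_le\<close> therefore bounds the
  risk by the expectation of a \<open>W\<close>-average, over dimensions \<open>k\<close>, of a stochastic error on the first
  \<open>k\<close> coordinates plus the tail energy of \<open>\<theta>\<^sub>0\<close> beyond \<open>k\<close>.

  It remains to see that \<open>W\<close> rarely charges a bad dimension. Compare with the dimension \<open>l\<close> of order
  \<open>(n / log n) powr (1 / (2\<beta> + 1))\<close>, for which \<open>l log n\<close>, \<open>n\<close> times the squared rate, and the
  Sobolev bound on \<open>n\<close> times the tail energy are of one order (\<open>oracle_dim_balance\<close>). Always
  \<open>W\<^sub>k \<le> W\<^sub>k / W\<^sub>l\<close>, and this quotient is a prior ratio times a product of Bayes factors or of their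
  inverses, one independent Gaussian coordinate per factor, so expectations can be computed exactly.

  \<^item> If \<open>k < l\<close> (\<open>underfit_weight\<close>), the inverse Bayes factors produce
  \<open>exp (- n b\<^sub>k / 4 + O(l log n))\<close>, where \<open>b\<^sub>k\<close> is the energy of \<open>\<theta>\<^sub>0\<close> in the coordinates from \<open>k\<close> to
  \<open>l\<close>. Hence only dimensions with \<open>b\<^sub>k\<close> of order \<open>l log n / n\<close> count, and the others contribute
  \<open>b exp (- n b / 8) \<le> 8 / n\<close> each.

  \<^item> If \<open>k > l\<close> (\<open>overfit_weight\<close>), a Bayes factor has expectation
  \<open>exp (n t\<^sub>i \<theta>\<^sub>i\<^sup>2 / 2)\<close>, which is useless for large \<open>t\<^sub>i\<close>. Since \<open>W\<^sub>k \<le> 1\<close>, one may bound \<open>W\<^sub>k\<close> by the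
  square root of the quotient instead, and the square root of a Bayes factor has expectation at most
  \<open>exp (n \<theta>\<^sub>i\<^sup>2 / 2)\<close>. The total loss \<open>exp (O(l log n))\<close> is beaten by the Poisson ratio
  \<open>(\<lambda> / l)^(k - l)\<close> once \<open>k\<close> exceeds a large multiple \<open>K = C l\<close>, because \<open>log l\<close> is of order
  \<open>log n\<close>.

  Dimensions up to \<open>K\<close> cost a stochastic error \<open>O(K / n)\<close>. The shrinkage bias is also \<open>O(K / n)\<close>,
  because \<open>q \<le> 1\<close> and \<open>\<beta> > 1/2\<close> give \<open>2q \<le> 2\<beta> + 1\<close>. Everything is bounded by a constant times
  \<open>l log n / n\<close>, that is, by a constant times the squared rate, with \<open>\<epsilon>\<^sub>0 = 1\<close>.
\<close>

section \<open>The noise and its Gaussian integrals\<close>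

abbreviation gauss :: "real measure" where
  "gauss \<equiv> density lborel (\<lambda>x. ennreal (std_normal_density x))"

lemma prob_space_gauss: "prob_space gauss"
  using prob_space_normal_density[of 1 0] by simp

interpretation noise: product_prob_space "\<lambda>_::nat. gauss" UNIV
  by (intro product_prob_spaceI prob_space_gauss)

lemma std_noise_eq: "std_noise = PiM UNIV (\<lambda>_. gauss)"
  by (simp add: std_noise_def)

lemma prob_space_std_noise: "prob_space std_noise"
  unfolding std_noise_eq by (rule noise.P.prob_space_axioms)

lemma sets_std_noise [measurable_cong]: "sets std_noise = sets seq_borel"
  unfolding std_noise_eq by (intro sets_PiM_cong) auto

lemma space_std_noise [simp]: "space std_noise = UNIV"
  by (simp add: std_noise_eq space_PiM)

lemma emeasure_std_noise [simp]: "emeasure std_noise UNIV = 1"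
  using prob_space.emeasure_space_1[OF prob_space_std_noise] by simp

text \<open>
  A product over finitely many coordinates is a function of a finite-dimensional marginal, so
  independence factorises its integral even for infinitely many coordinates.
\<close>
lemma nn_integral_std_noise_prod:
  assumes J: "finite J" and f [measurable]: "\<And>i. i \<in> J \<Longrightarrow> f i \<in> borel_measurable borel"
  shows "(\<integral>\<^sup>+\<xi>. (\<Prod>i\<in>J. f i (\<xi> i)) \<partial>std_noise) = (\<Prod>i\<in>J. \<integral>\<^sup>+z. f i z \<partial>gauss)"
proof -
  have "(\<integral>\<^sup>+\<xi>. (\<Prod>i\<in>J. f i (\<xi> i)) \<partial>std_noise)
      = (\<integral>\<^sup>+\<xi>. (\<Prod>i\<in>J. f i (restrict \<xi> J i)) \<partial>std_noise)"
    by (intro nn_integral_cong prod.cong) auto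
  also have "\<dots> = (\<integral>\<^sup>+\<xi>. (\<Prod>i\<in>J. f i (\<xi> i)) \<partial>distr std_noise (PiM J (\<lambda>_. gauss)) (\<lambda>\<xi>. restrict \<xi> J))"
    unfolding std_noise_eq
    by (subst nn_integral_distr) (auto intro!: measurable_restrict_subset borel_measurable_prod)
  also have "distr std_noise (PiM J (\<lambda>_. gauss)) (\<lambda>\<xi>. restrict \<xi> J) = PiM J (\<lambda>_. gauss)"
    unfolding std_noise_eq by (rule noise.distr_PiM_restrict_finite) (use J in auto)
  also have "(\<integral>\<^sup>+\<xi>. (\<Prod>i\<in>J. f i (\<xi> i)) \<partial>PiM J (\<lambda>_. gauss)) = (\<Prod>i\<in>J. \<integral>\<^sup>+z. f i z \<partial>gauss)"
    by (rule noise.product_nn_integral_prod) (use J in auto)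
  finally show ?thesis .
qed

lemma nn_integral_std_noise_coord:
  assumes "f \<in> borel_measurable borel"
  shows "(\<integral>\<^sup>+\<xi>. f (\<xi> i) \<partial>std_noise) = (\<integral>\<^sup>+z. f z \<partial>gauss)"
  using nn_integral_std_noise_prod[of "{i}" "\<lambda>_. f"] assms by simp

text \<open>
  Completing the square: an exponentiated quadratic turns the standard normal law into a multiple of
  another normal law. The posterior of one coordinate and all Bayes factor expectations are instances.
\<close>
lemma gauss_tilt:
  fixes b c :: real
  assumes c: "c < 1/2" and f [measurable]: "f \<in> borel_measurable borel"
  shows "(\<integral>\<^sup>+z. ennreal (exp (c * z\<^sup>2 + b * z)) * f z \<partial>gauss) =
    ennreal (exp (b\<^sup>2 / (2 * (1 - 2 * c))) / sqrt (1 - 2 * c)) *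
    (\<integral>\<^sup>+z. f z \<partial>density lborel (\<lambda>z. ennreal (normal_density (b / (1 - 2 * c)) (1 / sqrt (1 - 2 * c)) z)))"
proof -
  define d where "d = 1 - 2 * c"
  have d: "d > 0" using c by (simp add: d_def)
  have cd: "c = (1 - d) / 2" by (simp add: d_def)
  have key: "std_normal_density z * exp (c * z\<^sup>2 + b * z) =
     exp (b\<^sup>2 / (2 * d)) / sqrt d * normal_density (b / d) (1 / sqrt d) z" for z
  proof -
    have e: "- z\<^sup>2 / 2 + (c * z\<^sup>2 + b * z) = b\<^sup>2 / (2 * d) + - (z - b / d)\<^sup>2 / (2 * (1 / sqrt d)\<^sup>2)"
      using d unfolding cd by (simp add: power_divide) (simp add: field_simps power2_eq_square)
    have s: "sqrt (2 * pi * (1 / sqrt d)\<^sup>2) = sqrt (2 * pi) / sqrt d"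
      using d by (simp add: power_divide real_sqrt_divide)
    have "exp (- z\<^sup>2 / 2) * exp (c * z\<^sup>2 + b * z) =
        exp (b\<^sup>2 / (2 * d)) * exp (- (z - b / d)\<^sup>2 / (2 * (1 / sqrt d)\<^sup>2))"
      unfolding exp_add[symmetric] e ..
    then show ?thesis
      unfolding std_normal_density_def normal_density_def s
      using d by (simp add: field_simps)
  qed
  have "(\<integral>\<^sup>+z. ennreal (exp (c * z\<^sup>2 + b * z)) * f z \<partial>gauss) =
      (\<integral>\<^sup>+z. ennreal (exp (b\<^sup>2 / (2 * d)) / sqrt d) *
        (ennreal (normal_density (b / d) (1 / sqrt d) z) * f z) \<partial>lborel)"
    using d by (subst nn_integral_density)
       (auto simp: mult.assoc[symmetric] ennreal_mult'[symmetric] key intro!: nn_integral_cong)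
  also have "\<dots> = ennreal (exp (b\<^sup>2 / (2 * d)) / sqrt d) *
      (\<integral>\<^sup>+z. ennreal (normal_density (b / d) (1 / sqrt d) z) * f z \<partial>lborel)"
    by (rule nn_integral_cmult) auto
  finally show ?thesis
    unfolding d_def[symmetric] by (subst nn_integral_density) auto
qed

lemma gauss_exp_quadratic:
  fixes b c :: real
  assumes c: "c < 1/2"
  shows "(\<integral>\<^sup>+z. ennreal (exp (c * z\<^sup>2 + b * z)) \<partial>gauss) =
    ennreal (exp (b\<^sup>2 / (2 * (1 - 2 * c))) / sqrt (1 - 2 * c))"
  using gauss_tilt[OF c, of "\<lambda>_. 1" b]
    prob_space.emeasure_space_1[OF prob_space_normal_density[of "1 / sqrt (1 - 2 * c)" "b / (1 - 2 * c)"]] c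
  by simp

lemma gauss_exp_shifted_square:
  fixes s u :: real
  assumes s: "s < 1"
  shows "(\<integral>\<^sup>+z. ennreal (exp (s * (u + z)\<^sup>2 / 2)) \<partial>gauss) =
    ennreal (exp (s * u\<^sup>2 / (2 * (1 - s))) / sqrt (1 - s))"
proof -
  have "(\<integral>\<^sup>+z. ennreal (exp (s * (u + z)\<^sup>2 / 2)) \<partial>gauss) =
     (\<integral>\<^sup>+z. ennreal (exp (s * u\<^sup>2 / 2)) * ennreal (exp ((s/2) * z\<^sup>2 + s * u * z)) \<partial>gauss)"
    by (intro nn_integral_cong)
       (simp add: ennreal_mult'[symmetric] exp_add[symmetric] power2_sum algebra_simps add_divide_distrib)
  also have "\<dots> = ennreal (exp (s * u\<^sup>2 / 2)) * (\<integral>\<^sup>+z. ennreal (exp ((s/2) * z\<^sup>2 + s * u * z)) \<partial>gauss)"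
    by (rule nn_integral_cmult) auto
  also have "\<dots> = ennreal (exp (s * u\<^sup>2 / 2) * (exp ((s * u)\<^sup>2 / (2 * (1 - s))) / sqrt (1 - s)))"
    using s by (subst gauss_exp_quadratic) (auto simp: ennreal_mult'[symmetric])
  also have "exp (s * u\<^sup>2 / 2) * (exp ((s * u)\<^sup>2 / (2 * (1 - s))) / sqrt (1 - s)) =
     exp (s * u\<^sup>2 / (2 * (1 - s))) / sqrt (1 - s)"
  proof -
    have "s * u\<^sup>2 / 2 + (s * u)\<^sup>2 / (2 * (1 - s)) = s * u\<^sup>2 / (2 * (1 - s))"
      using s by (simp add: field_simps power2_eq_square)
    then show ?thesis by (simp add: exp_add[symmetric])
  qed
  finally show ?thesis .
qed

lemma normal_quadratic_moment:
  fixes m v s u :: real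
  assumes v: "v > 0"
  shows "(\<integral>\<^sup>+z. ennreal ((s * z - u)\<^sup>2) \<partial>density lborel (\<lambda>z. ennreal (normal_density m v z))) =
    ennreal ((s * m - u)\<^sup>2 + s\<^sup>2 * v\<^sup>2)"
proof -
  have 0: "has_bochner_integral lborel (\<lambda>x. normal_density m v x) 1"
    using normal_moment_even[OF v, of m 0] by simp
  have 1: "has_bochner_integral lborel (\<lambda>x. normal_density m v x * (x - m)) 0"
    using normal_moment_odd[OF v, of m 0] by simp
  have 2: "has_bochner_integral lborel (\<lambda>x. normal_density m v x * (x - m)\<^sup>2) (v\<^sup>2)"
    using normal_moment_even[OF v, of m 1] v by (simp add: fact_numeral)
  have "has_bochner_integral lborel
      (\<lambda>x. s\<^sup>2 * (normal_density m v x * (x - m)\<^sup>2) + 2 * s * (s * m - u) * (normal_density m v x * (x - m))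
         + (s * m - u)\<^sup>2 * normal_density m v x) (s\<^sup>2 * v\<^sup>2 + 2 * s * (s * m - u) * 0 + (s * m - u)\<^sup>2 * 1)"
    by (intro has_bochner_integral_add has_bochner_integral_mult_right 0 1 2)
  also have "(\<lambda>x. s\<^sup>2 * (normal_density m v x * (x - m)\<^sup>2) + 2 * s * (s * m - u) * (normal_density m v x * (x - m))
         + (s * m - u)\<^sup>2 * normal_density m v x) = (\<lambda>x. normal_density m v x * (s * x - u)\<^sup>2)"
    by (auto simp: algebra_simps power2_eq_square)
  finally have "(\<integral>\<^sup>+z. ennreal (normal_density m v z * (s * z - u)\<^sup>2) \<partial>lborel) =
     ennreal ((s * m - u)\<^sup>2 + s\<^sup>2 * v\<^sup>2)"
    by (subst nn_integral_eq_integral)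
       (auto simp: has_bochner_integral_iff algebra_simps normal_density_nonneg intro!: AE_I2)
  then show ?thesis
    by (subst nn_integral_density) (auto simp: ennreal_mult')
qed

text \<open>
  \<open>4 * 3 + 4 + 1\<close>, from the fourth and second moments; the quartic moment is what allows the squared noise
  to be decoupled from the posterior weights in \<open>weighted_le_quartic\<close>.
\<close>
lemma gauss_quartic_mean:
  "(\<integral>\<^sup>+z. ennreal ((2 * z\<^sup>2 + 1)\<^sup>2) \<partial>gauss) = 17"
proof -
  have 0: "has_bochner_integral lborel (\<lambda>x. std_normal_density x) 1"
    using std_normal_moment_even[of 0] by simp
  have 2: "has_bochner_integral lborel (\<lambda>x. std_normal_density x * x^2) 1"
    using std_normal_moment_even[of 1] by (simp add: fact_numeral)
  have 4: "has_bochner_integral lborel (\<lambda>x. std_normal_density x * x^4) 3"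
    using std_normal_moment_even[of 2] by (simp add: fact_numeral)
  have "has_bochner_integral lborel (\<lambda>x. 4 * (std_normal_density x * x^4) + 4 * (std_normal_density x * x^2)
         + std_normal_density x) (4 * 3 + 4 * 1 + 1)"
    by (intro has_bochner_integral_add has_bochner_integral_mult_right 0 2 4)
  also have "(\<lambda>x. 4 * (std_normal_density x * x^4) + 4 * (std_normal_density x * x^2)
         + std_normal_density x) = (\<lambda>x. std_normal_density x * (2 * x\<^sup>2 + 1)\<^sup>2)"
    by (auto simp: algebra_simps power2_eq_square power4_eq_xxxx)
  finally have "(\<integral>\<^sup>+z. ennreal (std_normal_density z * (2 * z\<^sup>2 + 1)\<^sup>2) \<partial>lborel) = 17"
    by (subst nn_integral_eq_integral)
       (auto simp: has_bochner_integral_iff intro!: AE_I2)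
  then show ?thesis
    by (subst nn_integral_density) (auto simp: ennreal_mult')
qed

lemma gauss_quadratic_mean: "(\<integral>\<^sup>+z. ennreal (2 * z\<^sup>2 + 1) \<partial>gauss) = 3"
proof -
  have "(\<integral>\<^sup>+z. ennreal (z\<^sup>2) \<partial>gauss) = 1"
    using normal_quadratic_moment[OF zero_less_one, where m=0 and s=1 and u=0]
    by (simp only: mult_1 diff_zero power_one power2_eq_square mult_zero_left add_0 ennreal_1)
  moreover have "(\<integral>\<^sup>+z. ennreal (2 * z\<^sup>2 + 1) \<partial>gauss) = (\<integral>\<^sup>+z. 2 * ennreal (z\<^sup>2) + 1 \<partial>gauss)"
    by (intro nn_integral_cong) (simp add: ennreal_mult' ennreal_plus)
  ultimately show ?thesis
    using prob_space.emeasure_space_1[OF prob_space_gauss]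
    by (subst (asm) nn_integral_add) (auto simp: nn_integral_cmult)
qed

text \<open>
  The one-dimensional Cameron-Martin formula in the scale of the observations: a mean \<open>u\<close> under noise level
  \<open>1 / r\<close> is the same as a likelihood ratio under mean \<open>0\<close>.
\<close>
lemma gauss_shift:
  fixes r u :: real
  assumes r: "r > 0" and f [measurable]: "f \<in> borel_measurable borel"
  shows "(\<integral>\<^sup>+z. f (u + z / r) \<partial>gauss) =
    (\<integral>\<^sup>+z. ennreal (exp (r\<^sup>2 * u * (z / r) - r\<^sup>2 * u\<^sup>2 / 2)) * f (z / r) \<partial>gauss)"
proof -
  have "(\<integral>\<^sup>+z. ennreal (exp (r\<^sup>2 * u * (z / r) - r\<^sup>2 * u\<^sup>2 / 2)) * f (z / r) \<partial>gauss) =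
     (\<integral>\<^sup>+z. ennreal (std_normal_density z * exp (r\<^sup>2 * u * (z / r) - r\<^sup>2 * u\<^sup>2 / 2)) * f (z / r) \<partial>lborel)"
    by (subst nn_integral_density) (auto simp: ennreal_mult' mult.assoc)
  also have "\<dots> = (\<integral>\<^sup>+z. ennreal (std_normal_density (z - r * u)) * f (z / r) \<partial>lborel)"
  proof (intro nn_integral_cong arg_cong2[where f="(*)"] arg_cong[where f=ennreal] refl)
    fix z
    have "- z\<^sup>2 / 2 + (r\<^sup>2 * u * (z / r) - r\<^sup>2 * u\<^sup>2 / 2) = - (z - r * u)\<^sup>2 / 2"
      using r by (simp add: field_simps power2_eq_square)
    then show "std_normal_density z * exp (r\<^sup>2 * u * (z / r) - r\<^sup>2 * u\<^sup>2 / 2) = std_normal_density (z - r * u)"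
      unfolding std_normal_density_def by (simp add: mult.assoc exp_add[symmetric])
  qed
  also have "\<dots> = (\<integral>\<^sup>+z. ennreal (std_normal_density z) * f (u + z / r) \<partial>lborel)"
    using r by (subst nn_integral_real_affine[where c=1 and t="r * u"])
       (auto simp: add_divide_distrib)
  also have "\<dots> = (\<integral>\<^sup>+z. f (u + z / r) \<partial>gauss)"
    by (subst nn_integral_density) auto
  finally show ?thesis ..
qed

section \<open>The explicit posterior\<close>

definition observe :: "nat \<Rightarrow> (nat \<Rightarrow> real) \<Rightarrow> (nat \<Rightarrow> real) \<Rightarrow> nat \<Rightarrow> real" where
  "observe n \<theta> \<xi> = (\<lambda>i. \<theta> i + \<xi> i / sqrt (real n))"

definition sieve_draw :: "(nat \<Rightarrow> real) \<Rightarrow> nat \<Rightarrow> (nat \<Rightarrow> real) \<Rightarrow> nat \<Rightarrow> real" where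
  "sieve_draw s k z = (\<lambda>i. if i < k then s i * z i else 0)"

text \<open>
  The density of the law of the observations under \<open>\<theta>\<close> with respect to the law under \<open>0\<close>, when \<open>\<theta>\<close>
  vanishes from index \<open>k\<close> on.
\<close>
definition lik_ratio :: "nat \<Rightarrow> nat \<Rightarrow> (nat \<Rightarrow> real) \<Rightarrow> (nat \<Rightarrow> real) \<Rightarrow> real" where
  "lik_ratio n k \<theta> x = (\<Prod>i<k. exp (real n * \<theta> i * x i - real n * (\<theta> i)\<^sup>2 / 2))"

text \<open>
  The Bayes factor of one coordinate, \<open>N(0, 1 + t)\<close> against \<open>N(0, 1)\<close>, at the observation \<open>y\<close> normalised to
  unit noise; \<open>t\<close> is the ratio of prior to noise variance.
\<close>
definition coord_bf :: "real \<Rightarrow> real \<Rightarrow> real" where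
  "coord_bf t y = exp (t / (1 + t) * y\<^sup>2 / 2) / sqrt (1 + t)"

text \<open>
  The marginal density of the observations given dimension \<open>k\<close>, relative to the law under \<open>0\<close>.
\<close>
definition evidence :: "nat \<Rightarrow> (nat \<Rightarrow> real) \<Rightarrow> nat \<Rightarrow> (nat \<Rightarrow> real) \<Rightarrow> real" where
  "evidence n s k x = (\<Prod>i<k. coord_bf (real n * (s i)\<^sup>2) (sqrt (real n) * x i))"

text \<open>
  The posterior mean of a coordinate with prior standard deviation \<open>\<sigma>\<close> is this factor times the
  observation.
\<close>
definition shrink :: "nat \<Rightarrow> real \<Rightarrow> real" where
  "shrink n \<sigma> = real n * \<sigma>\<^sup>2 / (1 + real n * \<sigma>\<^sup>2)"

text \<open>
  Posterior expected squared error for a coordinate with true value \<open>u\<close> and observation \<open>y\<close>: squared error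
  of the posterior mean plus posterior variance.
\<close>
definition coord_risk :: "nat \<Rightarrow> real \<Rightarrow> real \<Rightarrow> real \<Rightarrow> real" where
  "coord_risk n \<sigma> u y = (shrink n \<sigma> * y - u)\<^sup>2 + shrink n \<sigma> / real n"

definition tail_energy :: "nat \<Rightarrow> (nat \<Rightarrow> real) \<Rightarrow> real" where
  "tail_energy k \<theta> = (\<Sum>i. (\<theta> (i + k))\<^sup>2)"

text \<open>
  Posterior probability of dimension \<open>k\<close>. The denominator may be infinite for exceptional \<open>x\<close>; all weights
  are then \<open>0\<close>, which is why it is kept in the extended reals.
\<close>
definition dim_weight :: "nat pmf \<Rightarrow> nat \<Rightarrow> (nat \<Rightarrow> real) \<Rightarrow> nat \<Rightarrow> (nat \<Rightarrow> real) \<Rightarrow> ennreal" where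
  "dim_weight \<kappa> n s k x =
     ennreal (pmf \<kappa> k * evidence n s k x) / (\<Sum>j. ennreal (pmf \<kappa> j * evidence n s j x))"

lemma measurable_observe [measurable]: "observe n \<theta> \<in> measurable std_noise seq_borel"
  unfolding observe_def by (rule measurable_PiM_single') (auto simp: std_noise_eq space_PiM)

lemma wn_law_eq: "wn_law n \<theta> = distr std_noise seq_borel (observe n \<theta>)"
  unfolding wn_law_def observe_def[abs_def] ..

lemma sets_wn_law [measurable_cong, simp]: "sets (wn_law n \<theta>) = sets seq_borel"
  by (simp add: wn_law_def)

lemma prob_space_wn_law: "prob_space (wn_law n \<theta>)"
  unfolding wn_law_eq by (rule prob_space.prob_space_distr[OF prob_space_std_noise]) simp

lemma nn_integral_wn_law:
  assumes "f \<in> borel_measurable seq_borel"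
  shows "(\<integral>\<^sup>+x. f x \<partial>wn_law n \<theta>) = (\<integral>\<^sup>+\<xi>. f (observe n \<theta> \<xi>) \<partial>std_noise)"
  unfolding wn_law_eq using assms by (subst nn_integral_distr) auto

lemma measurable_lik_ratio [measurable]: "lik_ratio n k \<theta> \<in> borel_measurable seq_borel"
  unfolding lik_ratio_def[abs_def] by measurable

text \<open>
  Both sides are determined by cylinder sets, where they are products of one-dimensional integrals that agree
  by \<open>gauss_shift\<close>.
\<close>
lemma wn_law_density_lik_ratio:
  assumes n: "n > 0" and supp: "\<And>i. i \<ge> k \<Longrightarrow> \<theta> i = 0"
  shows "wn_law n \<theta> = density (wn_law n (\<lambda>_. 0)) (\<lambda>x. ennreal (lik_ratio n k \<theta> x))"
proof (rule measure_eqI_PiM_infinite[where I=UNIV and M="\<lambda>_. borel"])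
  fix A :: "nat \<Rightarrow> real set" and J :: "nat set"
  assume J: "finite J" and A: "\<And>i. i \<in> J \<Longrightarrow> A i \<in> sets borel"
  define X where "X = prod_emb UNIV (\<lambda>_. borel :: real measure) J (Pi\<^sub>E J A)"
  have X [measurable]: "X \<in> sets seq_borel"
    unfolding X_def using J A by (intro sets_PiM_I) auto
  define I where "I = J \<union> {..<k}"
  have I: "finite I" using J by (simp add: I_def)
  define f :: "nat \<Rightarrow> real \<Rightarrow> ennreal" where "f i = (if i \<in> J then indicator (A i) else (\<lambda>_. 1))" for i
  have f [measurable]: "f i \<in> borel_measurable borel" for i
    using A by (auto simp: f_def)
  \<comment> \<open>The cylinder and the likelihood ratio are both written as products over the same index set.\<close>
  have indX: "indicator X x = (\<Prod>i\<in>I. f i (x i))" for x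
  proof -
    have "(\<Prod>i\<in>I. f i (x i)) = (\<Prod>i\<in>J. indicator (A i) (x i))"
      unfolding I_def using J by (intro prod.mono_neutral_cong_right) (auto simp: f_def)
    also have "\<dots> = indicator X x"
    proof (cases "x \<in> X")
      case True
      then show ?thesis by (auto simp: X_def prod_emb_def Pi_iff intro!: prod.neutral)
    next
      case False
      then obtain j where "j \<in> J" "x j \<notin> A j" by (auto simp: X_def prod_emb_def PiE_def)
      then show ?thesis using False J by (auto intro!: prod_zero bexI[of _ j])
    qed
    finally show ?thesis ..
  qed
  define r where "r = sqrt (real n)"
  have r: "r > 0" "r\<^sup>2 = real n" using n by (auto simp: r_def)
  define g where "g i y = exp (r\<^sup>2 * \<theta> i * y - r\<^sup>2 * (\<theta> i)\<^sup>2 / 2)" for i y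
  have g [measurable]: "g i \<in> borel_measurable borel" for i unfolding g_def by measurable
  have lik: "ennreal (lik_ratio n k \<theta> x) = (\<Prod>i\<in>I. ennreal (g i (x i)))" for x
  proof -
    have "lik_ratio n k \<theta> x = (\<Prod>i\<in>I. g i (x i))"
      unfolding lik_ratio_def I_def g_def r using J supp by (intro prod.mono_neutral_cong_left) auto
    then show ?thesis by (simp add: prod_ennreal g_def)
  qed
  have "emeasure (wn_law n \<theta>) X = (\<integral>\<^sup>+x. indicator X x \<partial>wn_law n \<theta>)" by simp
  also have "\<dots> = (\<integral>\<^sup>+\<xi>. (\<Prod>i\<in>I. f i (\<theta> i + \<xi> i / r)) \<partial>std_noise)"
    by (subst nn_integral_wn_law) (auto simp: indX observe_def r_def)
  also have "\<dots> = (\<Prod>i\<in>I. \<integral>\<^sup>+z. f i (\<theta> i + z / r) \<partial>gauss)"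
    by (rule nn_integral_std_noise_prod[OF I, of "\<lambda>i z. f i (\<theta> i + z / r)"]) auto
  also have "\<dots> = (\<Prod>i\<in>I. \<integral>\<^sup>+z. ennreal (g i (z / r)) * f i (z / r) \<partial>gauss)"
    unfolding g_def using r by (intro prod.cong refl gauss_shift) auto
  also have "\<dots> = (\<integral>\<^sup>+\<xi>. (\<Prod>i\<in>I. ennreal (g i (\<xi> i / r)) * f i (\<xi> i / r)) \<partial>std_noise)"
    by (rule nn_integral_std_noise_prod[OF I, of "\<lambda>i z. ennreal (g i (z / r)) * f i (z / r)", symmetric]) auto
  also have "\<dots> = (\<integral>\<^sup>+x. ennreal (lik_ratio n k \<theta> x) * indicator X x \<partial>wn_law n (\<lambda>_. 0))"
    by (subst nn_integral_wn_law) (auto simp: indX lik observe_def r_def prod.distrib)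
  also have "\<dots> = emeasure (density (wn_law n (\<lambda>_. 0)) (\<lambda>x. ennreal (lik_ratio n k \<theta> x))) X"
    by (subst emeasure_density) auto
  finally show "emeasure (wn_law n \<theta>) (prod_emb UNIV (\<lambda>_. borel) J (Pi\<^sub>E J A)) =
     emeasure (density (wn_law n (\<lambda>_. 0)) (\<lambda>x. ennreal (lik_ratio n k \<theta> x)))
       (prod_emb UNIV (\<lambda>_. borel) J (Pi\<^sub>E J A))"
    by (simp add: X_def)
qed (use prob_space_wn_law[of n \<theta>] in \<open>auto simp: prob_space.finite_measure\<close>)

lemma finite_support_l2:
  assumes "\<And>i. i \<ge> k \<Longrightarrow> \<theta> i = 0"
  shows "\<theta> \<in> l2"
proof -
  have "summable (\<lambda>i. (\<theta> i)\<^sup>2)"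
    by (rule summable_finite[of "{..<k}"]) (use assms in auto)
  then show ?thesis by (simp add: l2_def)
qed

text \<open>
  A density is determined almost everywhere, so whatever version \<open>p\<close> is given, its ratios on finitely
  supported parameters are the explicit ones.
\<close>
lemma wn_densities_lik_ratio:
  assumes p: "wn_densities n \<mu> p" and n: "n > 0" and supp: "\<And>i. i \<ge> k \<Longrightarrow> \<theta> i = 0"
  shows "AE x in \<mu>. ennreal (p \<theta> x) = ennreal (p (\<lambda>_. 0) x) * ennreal (lik_ratio n k \<theta> x)"
proof -
  have [measurable_cong]: "sets \<mu> = sets seq_borel" using p by (simp add: wn_densities_def)
  have [measurable]: "(\<lambda>(\<theta>, x). p \<theta> x) \<in> borel_measurable (seq_borel \<Otimes>\<^sub>M seq_borel)"
    using p by (simp add: wn_densities_def)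
  have pm [measurable]: "p \<theta> \<in> borel_measurable seq_borel" for \<theta>
    using measurable_Pair2[of "\<lambda>(\<theta>, x). p \<theta> x" seq_borel seq_borel borel \<theta>]
    by (simp add: space_PiM)
  have d: "density \<mu> (\<lambda>x. ennreal (p \<theta> x)) = wn_law n \<theta>" if "\<theta> \<in> l2" for \<theta>
    using p that by (auto simp: wn_densities_def)
  have l2: "\<theta> \<in> l2" "(\<lambda>_. 0) \<in> l2"
    using finite_support_l2[OF supp] finite_support_l2[of 0 "\<lambda>_. 0"] by auto
  have "density \<mu> (\<lambda>x. ennreal (p \<theta> x)) = density (wn_law n (\<lambda>_. 0)) (\<lambda>x. ennreal (lik_ratio n k \<theta> x))"
    using d[OF l2(1)] wn_law_density_lik_ratio[OF n supp] by simp
  also have "\<dots> = density \<mu> (\<lambda>x. ennreal (p (\<lambda>_. 0) x) * ennreal (lik_ratio n k \<theta> x))"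
    unfolding d[OF l2(2), symmetric] by (rule density_density_eq) auto
  finally have "density \<mu> (\<lambda>x. ennreal (p \<theta> x)) =
      density \<mu> (\<lambda>x. ennreal (p (\<lambda>_. 0) x) * ennreal (lik_ratio n k \<theta> x))" .
  moreover have "sigma_finite_measure (density \<mu> (\<lambda>x. ennreal (p \<theta> x)))"
    unfolding d[OF l2(1)]
    using prob_space_wn_law prob_space_imp_sigma_finite by blast
  ultimately show ?thesis
    by (subst (asm) sigma_finite_density_unique) auto
qed

lemma measurable_sieve_draw [measurable]: "sieve_draw s k \<in> measurable seq_borel seq_borel"
  unfolding sieve_draw_def by (rule measurable_PiM_single') (auto simp: space_PiM)

lemma nn_integral_sieve:
  fixes \<kappa> :: "nat pmf"
  assumes f [measurable]: "f \<in> borel_measurable seq_borel"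
  shows "(\<integral>\<^sup>+\<theta>. f \<theta> \<partial>distr (measure_pmf \<kappa> \<Otimes>\<^sub>M std_noise) seq_borel (\<lambda>(k, z). sieve_draw s k z)) =
    (\<Sum>k. ennreal (pmf \<kappa> k) * (\<integral>\<^sup>+z. f (sieve_draw s k z) \<partial>std_noise))"
proof -
  interpret N: prob_space std_noise by (rule prob_space_std_noise)
  have [measurable]: "(\<lambda>(k, z). sieve_draw s k z) \<in> measurable (measure_pmf \<kappa> \<Otimes>\<^sub>M std_noise) seq_borel"
    unfolding sieve_draw_def split_beta
    by (rule measurable_PiM_single') (auto simp: space_PiM space_pair_measure)
  have "(\<integral>\<^sup>+\<theta>. f \<theta> \<partial>distr (measure_pmf \<kappa> \<Otimes>\<^sub>M std_noise) seq_borel (\<lambda>(k, z). sieve_draw s k z)) =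
     (\<integral>\<^sup>+kz. f (case kz of (k, z) \<Rightarrow> sieve_draw s k z) \<partial>(measure_pmf \<kappa> \<Otimes>\<^sub>M std_noise))"
    by (subst nn_integral_distr) auto
  also have "\<dots> = (\<integral>\<^sup>+k. \<integral>\<^sup>+z. f (sieve_draw s k z) \<partial>std_noise \<partial>measure_pmf \<kappa>)"
    by (subst N.nn_integral_fst[symmetric]) auto
  also have "\<dots> = (\<Sum>k. ennreal (pmf \<kappa> k) * (\<integral>\<^sup>+z. f (sieve_draw s k z) \<partial>std_noise))"
    by (simp add: nn_integral_measure_pmf nn_integral_count_space_nat)
  finally show ?thesis .
qed

text \<open>
  The exceptional set in \<open>wn_densities_lik_ratio\<close> depends on the parameter; Fubini turns it into a null set of
  observations that serves almost all draws from the prior at once.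
\<close>
lemma wn_densities_sieve_draw:
  assumes p: "wn_densities n \<mu> p" and n: "n > 0"
  shows "AE x in \<mu>. \<forall>k. AE z in std_noise. ennreal (p (sieve_draw s k z) x) =
           ennreal (p (\<lambda>_. 0) x) * ennreal (lik_ratio n k (sieve_draw s k z) x)"
proof (subst AE_all_countable, rule allI)
  fix k
  have [measurable_cong]: "sets \<mu> = sets seq_borel" using p by (simp add: wn_densities_def)
  have [measurable]: "(\<lambda>(\<theta>, x). p \<theta> x) \<in> borel_measurable (seq_borel \<Otimes>\<^sub>M seq_borel)"
    using p by (simp add: wn_densities_def)
  interpret M: sigma_finite_measure \<mu> using p by (simp add: wn_densities_def)
  interpret N: prob_space std_noise by (rule prob_space_std_noise)
  interpret pair_sigma_finite std_noise \<mu> ..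
  have [measurable]: "(\<lambda>zx. p (sieve_draw s k (fst zx)) (snd zx)) \<in> borel_measurable (std_noise \<Otimes>\<^sub>M \<mu>)"
    using measurable_compose[of "\<lambda>zx. (sieve_draw s k (fst zx), snd zx)" "std_noise \<Otimes>\<^sub>M \<mu>" "seq_borel \<Otimes>\<^sub>M seq_borel"
        "\<lambda>(\<theta>, x). p \<theta> x" borel] by simp
  have [measurable]: "(\<lambda>zx. p (\<lambda>_. 0) (snd zx)) \<in> borel_measurable (std_noise \<Otimes>\<^sub>M \<mu>)"
    using measurable_compose[of "\<lambda>zx. (\<lambda>_. 0, snd zx)" "std_noise \<Otimes>\<^sub>M \<mu>" "seq_borel \<Otimes>\<^sub>M seq_borel"
        "\<lambda>(\<theta>, x). p \<theta> x" borel] by (simp add: space_PiM)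
  have [measurable]: "(\<lambda>zx. lik_ratio n k (sieve_draw s k (fst zx)) (snd zx)) \<in> borel_measurable (std_noise \<Otimes>\<^sub>M \<mu>)"
    unfolding lik_ratio_def sieve_draw_def by measurable
  show "AE x in \<mu>. AE z in std_noise. ennreal (p (sieve_draw s k z) x) =
           ennreal (p (\<lambda>_. 0) x) * ennreal (lik_ratio n k (sieve_draw s k z) x)"
  proof (subst AE_commute[symmetric])
    show "AE z in std_noise. AE x in \<mu>. ennreal (p (sieve_draw s k z) x) =
           ennreal (p (\<lambda>_. 0) x) * ennreal (lik_ratio n k (sieve_draw s k z) x)"
      by (intro AE_I2 wn_densities_lik_ratio[OF p n]) (simp add: sieve_draw_def)
  qed measurable
qed

lemma coord_bf_pos: "t \<ge> 0 \<Longrightarrow> coord_bf t y > 0"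
  by (simp add: coord_bf_def)

lemma evidence_pos: "evidence n s k x > 0"
  unfolding evidence_def by (intro prod_pos) (simp add: coord_bf_pos)

lemma measurable_evidence [measurable]: "evidence n s k \<in> borel_measurable seq_borel"
  unfolding evidence_def[abs_def] coord_bf_def by measurable

lemma shrink_nonneg: "0 \<le> shrink n \<sigma>"
  by (simp add: shrink_def)

lemma coord_risk_nonneg: "0 \<le> coord_risk n \<sigma> u y"
  by (simp add: coord_risk_def shrink_nonneg)

text \<open>
  Instances of \<open>gauss_tilt\<close> with quadratic coefficient \<open>- n \<sigma>\<^sup>2 / 2\<close> and linear coefficient \<open>n \<sigma> y\<close>: the tilted
  law of \<open>\<sigma> z\<close> is the posterior of the coordinate.
\<close>
lemma coord_lik:
  assumes n: "n > 0"
  shows "(\<integral>\<^sup>+z. ennreal (exp (real n * (\<sigma> * z) * y - real n * (\<sigma> * z)\<^sup>2 / 2)) \<partial>gauss) =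
     ennreal (coord_bf (real n * \<sigma>\<^sup>2) (sqrt (real n) * y))"
    and "(\<integral>\<^sup>+z. ennreal (exp (real n * (\<sigma> * z) * y - real n * (\<sigma> * z)\<^sup>2 / 2)) * ennreal ((\<sigma> * z - u)\<^sup>2) \<partial>gauss) =
     ennreal (coord_bf (real n * \<sigma>\<^sup>2) (sqrt (real n) * y)) * ennreal (coord_risk n \<sigma> u y)"
proof -
  define t where "t = real n * \<sigma>\<^sup>2"
  have t: "t \<ge> 0" by (simp add: t_def)
  have e: "real n * (\<sigma> * z) * y - real n * (\<sigma> * z)\<^sup>2 / 2 = (- t / 2) * z\<^sup>2 + (real n * \<sigma> * y) * z" for z
    by (simp add: t_def power_mult_distrib algebra_simps)
  have d: "1 - 2 * (- t / 2) = 1 + t" by simp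
  have b: "exp ((real n * \<sigma> * y)\<^sup>2 / (2 * (1 + t))) / sqrt (1 + t) = coord_bf t (sqrt (real n) * y)"
  proof -
    have "(real n * \<sigma> * y)\<^sup>2 / (2 * (1 + t)) = t / (1 + t) * (sqrt (real n) * y)\<^sup>2 / 2"
      using t by (simp add: power_mult_distrib) (simp add: t_def field_simps power2_eq_square)
    then show ?thesis by (simp add: coord_bf_def)
  qed
  have c: "- t / 2 < 1 / 2" using t by simp
  show "(\<integral>\<^sup>+z. ennreal (exp (real n * (\<sigma> * z) * y - real n * (\<sigma> * z)\<^sup>2 / 2)) \<partial>gauss) =
     ennreal (coord_bf (real n * \<sigma>\<^sup>2) (sqrt (real n) * y))"
    unfolding e gauss_exp_quadratic[OF c] d b unfolding t_def ..
  have v: "1 / sqrt (1 + t) > 0" using t by simp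
  have "(\<integral>\<^sup>+z. ennreal (exp (real n * (\<sigma> * z) * y - real n * (\<sigma> * z)\<^sup>2 / 2)) * ennreal ((\<sigma> * z - u)\<^sup>2) \<partial>gauss) =
     ennreal (coord_bf t (sqrt (real n) * y)) *
     ennreal ((\<sigma> * (real n * \<sigma> * y / (1 + t)) - u)\<^sup>2 + \<sigma>\<^sup>2 * (1 / sqrt (1 + t))\<^sup>2)"
    unfolding e by (subst gauss_tilt[OF c]) (auto simp only: d b normal_quadratic_moment[OF v], measurable)
  also have "(\<sigma> * (real n * \<sigma> * y / (1 + t)) - u)\<^sup>2 + \<sigma>\<^sup>2 * (1 / sqrt (1 + t))\<^sup>2 = coord_risk n \<sigma> u y"
    using t n by (simp add: coord_risk_def shrink_def t_def[symmetric] power_divide)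
       (simp add: t_def power2_eq_square mult_ac)
  finally show "(\<integral>\<^sup>+z. ennreal (exp (real n * (\<sigma> * z) * y - real n * (\<sigma> * z)\<^sup>2 / 2)) * ennreal ((\<sigma> * z - u)\<^sup>2) \<partial>gauss) =
     ennreal (coord_bf (real n * \<sigma>\<^sup>2) (sqrt (real n) * y)) * ennreal (coord_risk n \<sigma> u y)"
    by (simp add: t_def)
qed

lemma lik_ratio_sieve_draw:
  "ennreal (lik_ratio n k (sieve_draw s k z) x) =
     (\<Prod>i<k. ennreal (exp (real n * (s i * z i) * x i - real n * (s i * z i)\<^sup>2 / 2)))"
  by (simp add: lik_ratio_def sieve_draw_def prod_ennreal)

lemma nn_integral_lik_ratio:
  assumes n: "n > 0"
  shows "(\<integral>\<^sup>+z. ennreal (lik_ratio n k (sieve_draw s k z) x) \<partial>std_noise) = ennreal (evidence n s k x)"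
  unfolding lik_ratio_sieve_draw evidence_def
  by (subst nn_integral_std_noise_prod[where f="\<lambda>i z. ennreal (exp (real n * (s i * z) * x i - real n * (s i * z)\<^sup>2 / 2))"])
     (auto simp: coord_lik(1)[OF n] prod_ennreal coord_bf_pos less_imp_le)

lemma nn_integral_lik_ratio_coord:
  assumes n: "n > 0" and j: "j < k"
  shows "(\<integral>\<^sup>+z. ennreal (lik_ratio n k (sieve_draw s k z) x) * ennreal ((s j * z j - u)\<^sup>2) \<partial>std_noise) =
    ennreal (evidence n s k x) * ennreal (coord_risk n (s j) u (x j))"
proof -
  define l where "l i z = ennreal (exp (real n * (s i * z) * x i - real n * (s i * z)\<^sup>2 / 2))" for i z
  have [measurable]: "l i \<in> borel_measurable borel" for i unfolding l_def by measurable
  define f where "f i z = (if i = j then l i z * ennreal ((s j * z - u)\<^sup>2) else l i z)" for i z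
  have [measurable]: "f i \<in> borel_measurable borel" for i unfolding f_def by measurable
  have split: "(\<Prod>i<k. h i) = h j * (\<Prod>i\<in>{..<k} - {j}. h i)" for h :: "nat \<Rightarrow> ennreal"
    using j by (intro prod.remove) auto
  have "(\<integral>\<^sup>+z. ennreal (lik_ratio n k (sieve_draw s k z) x) * ennreal ((s j * z j - u)\<^sup>2) \<partial>std_noise) =
      (\<integral>\<^sup>+z. (\<Prod>i<k. f i (z i)) \<partial>std_noise)"
    unfolding lik_ratio_sieve_draw l_def[symmetric] by (subst (1 2) split) (simp add: f_def mult_ac)
  also have "\<dots> = (\<Prod>i<k. \<integral>\<^sup>+z. f i z \<partial>gauss)"
    by (rule nn_integral_std_noise_prod) auto
  also have "\<dots> = (\<Prod>i<k. \<integral>\<^sup>+z. l i z \<partial>gauss) * ennreal (coord_risk n (s j) u (x j))"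
  proof -
    have "(\<integral>\<^sup>+z. f j z \<partial>gauss) = (\<integral>\<^sup>+z. l j z \<partial>gauss) * ennreal (coord_risk n (s j) u (x j))"
      by (simp add: f_def l_def coord_lik[OF n])
    moreover have "(\<Prod>i\<in>{..<k} - {j}. \<integral>\<^sup>+z. f i z \<partial>gauss) = (\<Prod>i\<in>{..<k} - {j}. \<integral>\<^sup>+z. l i z \<partial>gauss)"
      by (intro prod.cong) (auto simp: f_def)
    ultimately show ?thesis by (subst (1 2) split) (simp only: mult_ac)
  qed
  also have "(\<Prod>i<k. \<integral>\<^sup>+z. l i z \<partial>gauss) = ennreal (evidence n s k x)"
    unfolding l_def coord_lik(1)[OF n] evidence_def by (simp add: prod_ennreal coord_bf_pos less_imp_le)
  finally show ?thesis .
qed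

text \<open>
  Coordinates from \<open>k\<close> on are \<open>0\<close> in the draw, so there the loss is the energy of the true parameter.
\<close>
lemma l2_norm_sieve_draw:
  assumes "\<theta>0 \<in> l2"
  shows "(l2_norm (sieve_draw s k z - \<theta>0))\<^sup>2 = (\<Sum>i<k. (s i * z i - \<theta>0 i)\<^sup>2) + tail_energy k \<theta>0"
proof -
  let ?f = "\<lambda>i. ((sieve_draw s k z - \<theta>0) i)\<^sup>2"
  have t: "?f (i + k) = (\<theta>0 (i + k))\<^sup>2" for i by (simp add: sieve_draw_def)
  have "summable (\<lambda>i. (\<theta>0 (i + k))\<^sup>2)" using assms unfolding l2_def by (intro summable_ignore_initial_segment) simp
  then have sm: "summable ?f" using t summable_iff_shift[of ?f k] by simp
  have "(l2_norm (sieve_draw s k z - \<theta>0))\<^sup>2 = (\<Sum>i. ?f i)"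
    unfolding l2_norm_def using suminf_nonneg[OF sm] by simp
  also have "\<dots> = (\<Sum>i. ?f (i + k)) + (\<Sum>i<k. ?f i)"
    by (rule suminf_split_initial_segment[OF sm])
  finally show ?thesis by (simp add: t tail_energy_def sieve_draw_def)
qed

lemma tail_energy_nonneg: "\<theta> \<in> l2 \<Longrightarrow> 0 \<le> tail_energy k \<theta>"
  unfolding tail_energy_def l2_def by (intro suminf_nonneg summable_ignore_initial_segment) auto

lemma nn_integral_lik_ratio_loss:
  assumes n: "n > 0" and \<theta>0: "\<theta>0 \<in> l2"
  shows "(\<integral>\<^sup>+z. ennreal (lik_ratio n k (sieve_draw s k z) x) * ennreal ((l2_norm (sieve_draw s k z - \<theta>0))\<^sup>2) \<partial>std_noise) =
    ennreal (evidence n s k x) * ennreal ((\<Sum>i<k. coord_risk n (s i) (\<theta>0 i) (x i)) + tail_energy k \<theta>0)"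
proof -
  let ?l = "\<lambda>z. ennreal (lik_ratio n k (sieve_draw s k z) x)"
  have [measurable]: "?l \<in> borel_measurable std_noise" unfolding lik_ratio_sieve_draw by measurable
  have "(\<integral>\<^sup>+z. ?l z * ennreal ((l2_norm (sieve_draw s k z - \<theta>0))\<^sup>2) \<partial>std_noise) =
     (\<integral>\<^sup>+z. (\<Sum>i<k. ?l z * ennreal ((s i * z i - \<theta>0 i)\<^sup>2)) + ?l z * ennreal (tail_energy k \<theta>0) \<partial>std_noise)"
    using tail_energy_nonneg[OF \<theta>0]
    by (intro nn_integral_cong)
       (simp add: l2_norm_sieve_draw[OF \<theta>0] ennreal_plus sum_nonneg sum_ennreal[symmetric] distrib_left sum_distrib_left
         del: sum_ennreal)
  also have "\<dots> = (\<Sum>i<k. \<integral>\<^sup>+z. ?l z * ennreal ((s i * z i - \<theta>0 i)\<^sup>2) \<partial>std_noise) +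
      (\<integral>\<^sup>+z. ?l z * ennreal (tail_energy k \<theta>0) \<partial>std_noise)"
    by (subst nn_integral_add) (auto simp: nn_integral_sum)
  also have "\<dots> = (\<Sum>i<k. ennreal (evidence n s k x) * ennreal (coord_risk n (s i) (\<theta>0 i) (x i))) +
      ennreal (evidence n s k x) * ennreal (tail_energy k \<theta>0)"
    by (simp add: nn_integral_lik_ratio_coord[OF n] nn_integral_multc nn_integral_lik_ratio[OF n])
  also have "\<dots> = ennreal (evidence n s k x) * ennreal ((\<Sum>i<k. coord_risk n (s i) (\<theta>0 i) (x i)) + tail_energy k \<theta>0)"
    using tail_energy_nonneg[OF \<theta>0]
    by (simp add: ennreal_plus sum_nonneg sum_ennreal[symmetric] distrib_left sum_distrib_left coord_risk_nonneg
         del: sum_ennreal)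
  finally show ?thesis .
qed

lemma measurable_loss [measurable]:
  "(\<lambda>\<theta>. (l2_norm (\<theta> - \<theta>0))\<^sup>2) \<in> borel_measurable seq_borel"
  unfolding l2_norm_def fun_diff_def by measurable

text \<open>
  Bayes' formula with the explicit likelihood ratios. The unknown factor \<open>p 0 x\<close> cancels where it is positive.
  Where it vanishes, the normalising constant vanishes too and, with \<open>0 / 0 = 0\<close>, the posterior is the null
  measure, so that only an inequality is claimed. Sets that are null for \<open>\<mu>\<close> are null for the law under \<open>\<theta>0\<close>, which
  has a density.
\<close>
lemma posterior_risk_le:
  fixes \<kappa> :: "nat pmf"
  assumes p: "wn_densities n \<mu> p" and n: "n > 0" and \<theta>0: "\<theta>0 \<in> l2"
    and \<pi>: "\<pi> = distr (measure_pmf \<kappa> \<Otimes>\<^sub>M std_noise) seq_borel (\<lambda>(k, z). sieve_draw s k z)"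
  shows "posterior_risk \<pi> n p \<theta>0 \<le>
    (\<integral>\<^sup>+x. (\<Sum>k. dim_weight \<kappa> n s k x *
       ennreal ((\<Sum>i<k. coord_risk n (s i) (\<theta>0 i) (x i)) + tail_energy k \<theta>0)) \<partial>wn_law n \<theta>0)"
proof -
  have [measurable_cong]: "sets \<mu> = sets seq_borel" using p by (simp add: wn_densities_def)
  have pm [measurable]: "(\<lambda>(\<theta>, x). p \<theta> x) \<in> borel_measurable (seq_borel \<Otimes>\<^sub>M seq_borel)"
    using p by (simp add: wn_densities_def)
  have [measurable]: "p \<theta> \<in> borel_measurable seq_borel" for \<theta>
    using measurable_Pair2[OF pm, of \<theta>] by (simp add: space_PiM)
  have [measurable]: "(\<lambda>\<theta>. p \<theta> x) \<in> borel_measurable seq_borel" for x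
    using measurable_Pair1[OF pm, of x] by (simp add: space_PiM)
  have [measurable_cong]: "sets \<pi> = sets seq_borel" by (simp add: \<pi>)
  have d: "density \<mu> (\<lambda>x. ennreal (p \<theta>0 x)) = wn_law n \<theta>0"
    using p \<theta>0 by (auto simp: wn_densities_def)
  let ?loss = "\<lambda>\<theta>. ennreal ((l2_norm (\<theta> - \<theta>0))\<^sup>2)"
  let ?C = "\<lambda>k x. ennreal ((\<Sum>i<k. coord_risk n (s i) (\<theta>0 i) (x i)) + tail_energy k \<theta>0)"
  let ?L = "\<lambda>k z x. ennreal (lik_ratio n k (sieve_draw s k z) x)"
  have ptw: "(\<integral>\<^sup>+\<theta>. ?loss \<theta> \<partial>posterior \<pi> p x) \<le> (\<Sum>k. dim_weight \<kappa> n s k x * ?C k x)"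
    if x: "\<forall>k. AE z in std_noise. ennreal (p (sieve_draw s k z) x) = ennreal (p (\<lambda>_. 0) x) * ?L k z x" for x
  proof -
    define S where "S = (\<Sum>j. ennreal (pmf \<kappa> j * evidence n s j x))"
    define p0 where "p0 = ennreal (p (\<lambda>_. 0) x)"
    have [measurable]: "(\<lambda>z. ?L k z x) \<in> borel_measurable std_noise" for k
      unfolding lik_ratio_sieve_draw by measurable
    have D: "(\<integral>\<^sup>+\<theta>. ennreal (p \<theta> x) \<partial>\<pi>) = p0 * S"
    proof -
      have "(\<integral>\<^sup>+\<theta>. ennreal (p \<theta> x) \<partial>\<pi>) =
          (\<Sum>k. ennreal (pmf \<kappa> k) * (\<integral>\<^sup>+z. ennreal (p (sieve_draw s k z) x) \<partial>std_noise))"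
        unfolding \<pi> by (rule nn_integral_sieve) measurable
      also have "\<dots> = (\<Sum>k. ennreal (pmf \<kappa> k) * (\<integral>\<^sup>+z. p0 * ?L k z x \<partial>std_noise))"
        unfolding p0_def using x by (intro suminf_cong arg_cong2[where f="(*)"] refl nn_integral_cong_AE) blast
      also have "\<dots> = (\<Sum>k. p0 * ennreal (pmf \<kappa> k * evidence n s k x))"
        by (simp add: nn_integral_cmult nn_integral_lik_ratio[OF n] ennreal_mult evidence_pos less_imp_le mult_ac)
      finally show ?thesis by (simp add: S_def)
    qed
    have "(\<integral>\<^sup>+\<theta>. ?loss \<theta> \<partial>posterior \<pi> p x) = (\<integral>\<^sup>+\<theta>. ennreal (p \<theta> x) / (p0 * S) * ?loss \<theta> \<partial>\<pi>)"
      unfolding posterior_def D by (subst nn_integral_density) auto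
    also have "\<dots> = (\<Sum>k. ennreal (pmf \<kappa> k) *
        (\<integral>\<^sup>+z. ennreal (p (sieve_draw s k z) x) / (p0 * S) * ?loss (sieve_draw s k z) \<partial>std_noise))"
      unfolding \<pi> by (rule nn_integral_sieve) measurable
    also have "\<dots> = (\<Sum>k. ennreal (pmf \<kappa> k) *
        (\<integral>\<^sup>+z. p0 / (p0 * S) * (?L k z x * ?loss (sieve_draw s k z)) \<partial>std_noise))"
    proof (intro suminf_cong arg_cong2[where f="(*)"] refl nn_integral_cong_AE)
      fix k
      show "AE z in std_noise. ennreal (p (sieve_draw s k z) x) / (p0 * S) * ?loss (sieve_draw s k z) =
          p0 / (p0 * S) * (?L k z x * ?loss (sieve_draw s k z))"
        using x[rule_format, of k] by eventually_elim (simp add: p0_def ennreal_divide_times mult_ac divide_ennreal_def)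
    qed
    also have "\<dots> = (\<Sum>k. (p0 / (p0 * S)) * (ennreal (pmf \<kappa> k * evidence n s k x) * ?C k x))"
      by (subst nn_integral_cmult)
         (auto simp: nn_integral_lik_ratio_loss[OF n \<theta>0] ennreal_mult evidence_pos less_imp_le mult_ac)
    also have "\<dots> \<le> (\<Sum>k. (1 / S) * (ennreal (pmf \<kappa> k * evidence n s k x) * ?C k x))"
    proof (intro suminf_le mult_right_mono)
      \<comment> \<open>Not an equality when \<open>p0 = 0\<close>.\<close>
      show "p0 / (p0 * S) \<le> 1 / S"
      proof (cases "p0 = 0")
        case False
        then have "1 * p0 / (S * p0) = 1 / S" by (intro divide_mult_eq) (auto simp: p0_def)
        then show ?thesis by (simp add: mult.commute)
      qed auto
    qed auto
    also have "\<dots> = (\<Sum>k. dim_weight \<kappa> n s k x * ?C k x)"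
      by (simp add: dim_weight_def S_def divide_ennreal_def mult_ac)
    finally show ?thesis .
  qed
  have "AE x in wn_law n \<theta>0. \<forall>k. AE z in std_noise. ennreal (p (sieve_draw s k z) x) = ennreal (p (\<lambda>_. 0) x) * ?L k z x"
    unfolding d[symmetric] using wn_densities_sieve_draw[OF p n, of s]
    by (subst AE_density) (auto elim: eventually_mono)
  then show ?thesis
    unfolding posterior_risk_def
    by (intro nn_integral_mono_AE) (erule eventually_mono, rule ptw)
qed

section \<open>Posterior weights of wrong dimensions\<close>

lemma dim_weight_suminf_le_1: "(\<Sum>k. dim_weight \<kappa> n s k x) \<le> 1"
proof -
  define S where "S = (\<Sum>j. ennreal (pmf \<kappa> j * evidence n s j x))"
  have "(\<Sum>k. dim_weight \<kappa> n s k x) = S / S"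
    by (simp add: dim_weight_def S_def)
  also have "\<dots> \<le> 1"
  proof -
    consider "S = 0" | "S = top" | "S \<noteq> 0" "S < top" by (cases "S = top") (auto simp: less_top)
    then show ?thesis by cases auto
  qed
  finally show ?thesis .
qed

lemma dim_weight_le_1: "dim_weight \<kappa> n s k x \<le> 1"
proof -
  have "dim_weight \<kappa> n s k x = (\<Sum>j\<in>{k}. dim_weight \<kappa> n s j x)" by simp
  also have "\<dots> \<le> (\<Sum>j. dim_weight \<kappa> n s j x)" by (rule sum_le_suminf) auto
  finally show ?thesis using dim_weight_suminf_le_1[of \<kappa> n s x] by (rule order_trans)
qed

lemma measurable_dim_weight [measurable]: "dim_weight \<kappa> n s k \<in> borel_measurable seq_borel"
  unfolding dim_weight_def[abs_def] by measurable

lemma ennreal_divide_left_mono: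
  fixes a b c :: ennreal
  assumes "b \<le> c" "0 < b" "b < top"
  shows "a / c \<le> a / b"
proof (rule divide_le_posI_ennreal)
  show "0 < c" using assms by simp
  have "a = (a / b) * b"
    using assms by (simp add: ennreal_divide_times)
  also have "\<dots> \<le> (a / b) * c" using assms by (intro mult_left_mono) auto
  finally show "a \<le> c * (a / b)" by (simp add: mult.commute)
qed

lemma prod_mono_ennreal:
  fixes f g :: "'i \<Rightarrow> ennreal"
  assumes "\<And>i. i \<in> I \<Longrightarrow> f i \<le> g i"
  shows "(\<Prod>i\<in>I. f i) \<le> (\<Prod>i\<in>I. g i)"
  using assms by (induction I rule: infinite_finite_induct) (auto intro!: mult_mono)

lemma sqrt_prod: "sqrt (\<Prod>i\<in>I. f i) = (\<Prod>i\<in>I. sqrt (f i))"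
  by (induction I rule: infinite_finite_induct) (auto simp: real_sqrt_mult)

lemma dim_weight_le_ratio:
  assumes "pmf \<kappa> j > 0"
  shows "dim_weight \<kappa> n s k x \<le> ennreal (pmf \<kappa> k / pmf \<kappa> j * (evidence n s k x / evidence n s j x))"
proof -
  have pos: "pmf \<kappa> j * evidence n s j x > 0" using assms evidence_pos by simp
  have "ennreal (pmf \<kappa> j * evidence n s j x) \<le> (\<Sum>j. ennreal (pmf \<kappa> j * evidence n s j x))"
    using sum_le_suminf[of "\<lambda>j. ennreal (pmf \<kappa> j * evidence n s j x)" "{j}"] by simp
  then have "dim_weight \<kappa> n s k x \<le> ennreal (pmf \<kappa> k * evidence n s k x) / ennreal (pmf \<kappa> j * evidence n s j x)"
    unfolding dim_weight_def using pos by (intro ennreal_divide_left_mono) auto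
  also have "\<dots> = ennreal (pmf \<kappa> k / pmf \<kappa> j * (evidence n s k x / evidence n s j x))"
    using pos by (subst divide_ennreal) (auto simp: less_imp_le evidence_pos)
  finally show ?thesis .
qed

lemma evidence_split:
  assumes "k \<le> l"
  shows "evidence n s l x = evidence n s k x *
    (\<Prod>i\<in>{k..<l}. coord_bf (real n * (s i)\<^sup>2) (sqrt (real n) * x i))"
proof -
  have "{..<l} = {..<k} \<union> {k..<l}" using assms by auto
  then show ?thesis unfolding evidence_def by (simp add: prod.union_disjoint ivl_disj_int)
qed

text \<open>
  Since \<open>a = t / (1 + t) \<le> 1\<close>, the exact exponent \<open>- a u\<^sup>2 / (2 (1 + a))\<close> is at most \<open>- a u\<^sup>2 / 4\<close>: a signal \<open>u\<close> makes
  the inverse Bayes factor exponentially small.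
\<close>
lemma gauss_inverse_coord_bf:
  assumes t: "t \<ge> 0"
  shows "(\<integral>\<^sup>+z. ennreal (1 / coord_bf t (u + z)) \<partial>gauss) \<le>
    ennreal (sqrt (1 + t) * exp (- (t / (1 + t) * u\<^sup>2 / 4)))"
proof -
  define a where "a = t / (1 + t)"
  have a: "0 \<le> a" "a \<le> 1" using t by (auto simp: a_def)
  have "1 / coord_bf t y = sqrt (1 + t) * exp (- a * y\<^sup>2 / 2)" for y
    by (simp add: coord_bf_def a_def[symmetric] exp_minus field_simps)
  then have "(\<integral>\<^sup>+z. ennreal (1 / coord_bf t (u + z)) \<partial>gauss) =
     ennreal (sqrt (1 + t)) * (\<integral>\<^sup>+z. ennreal (exp (- a * (u + z)\<^sup>2 / 2)) \<partial>gauss)"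
    using t by (simp add: ennreal_mult' nn_integral_cmult)
  also have "\<dots> = ennreal (sqrt (1 + t) * (exp (- a * u\<^sup>2 / (2 * (1 + a))) / sqrt (1 + a)))"
    using t a by (subst gauss_exp_shifted_square) (auto simp: ennreal_mult'[symmetric])
  also have "\<dots> \<le> ennreal (sqrt (1 + t) * exp (- (a * u\<^sup>2 / 4)))"
  proof (intro ennreal_leI mult_left_mono)
    have "exp (- a * u\<^sup>2 / (2 * (1 + a))) / sqrt (1 + a) \<le> exp (- a * u\<^sup>2 / (2 * (1 + a))) / 1"
      using a by (intro divide_left_mono) auto
    also have "a * u\<^sup>2 / 4 \<le> a * u\<^sup>2 / (2 * (1 + a))"
      using a by (intro divide_left_mono) auto
    then have "exp (- a * u\<^sup>2 / (2 * (1 + a))) / 1 \<le> exp (- (a * u\<^sup>2 / 4))" by simp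
    finally show "exp (- a * u\<^sup>2 / (2 * (1 + a))) / sqrt (1 + a) \<le> exp (- (a * u\<^sup>2 / 4))" .
  qed (use t in auto)
  finally show ?thesis by (simp add: a_def)
qed

text \<open>
  The square root halves the exponent, so that the integral is \<open>exp (a u\<^sup>2 / (4 - 2 a)) / (c sqrt (1 - a / 2))\<close> with
  \<open>c = (1 + t) powr (1/4)\<close>. Its exponent is at most \<open>u\<^sup>2 / 2\<close> whatever \<open>t\<close> is, and its denominator is at least \<open>1\<close>
  because \<open>sqrt (1 + t) \<le> 1 + t / 2\<close>. Without the square root the exponent would be \<open>t u\<^sup>2 / 2\<close>.
\<close>
lemma gauss_sqrt_coord_bf:
  assumes t: "t \<ge> 0"
  shows "(\<integral>\<^sup>+z. ennreal (sqrt (coord_bf t (u + z))) \<partial>gauss) \<le> ennreal (exp (u\<^sup>2 / 2))"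
proof -
  define a where "a = t / (1 + t)"
  have a: "0 \<le> a" "a \<le> 1" "a / 2 < 1" using t by (auto simp: a_def)
  define c where "c = sqrt (sqrt (1 + t))"
  have c: "c > 0" using t by (simp add: c_def)
  have se: "sqrt (exp v) = exp (v / 2)" for v :: real
    by (rule real_sqrt_unique) (auto simp: exp_double[symmetric])
  have "sqrt (coord_bf t y) = (1 / c) * exp (a / 2 * y\<^sup>2 / 2)" for y
    by (simp add: coord_bf_def a_def[symmetric] c_def real_sqrt_divide se)
  then have "(\<integral>\<^sup>+z. ennreal (sqrt (coord_bf t (u + z))) \<partial>gauss) =
     ennreal (1 / c) * (\<integral>\<^sup>+z. ennreal (exp (a / 2 * (u + z)\<^sup>2 / 2)) \<partial>gauss)"
    using c by (simp add: ennreal_mult'[symmetric] nn_integral_cmult[symmetric])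
  also have "\<dots> = ennreal (1 / c * (exp (a / 2 * u\<^sup>2 / (2 * (1 - a / 2))) / sqrt (1 - a / 2)))"
    using c unfolding gauss_exp_shifted_square[OF a(3)] by (simp only: ennreal_mult' less_imp_le zero_le_divide_1_iff)
  also have "\<dots> \<le> ennreal (exp (u\<^sup>2 / 2))"
  proof (rule ennreal_leI)
    have "1 \<le> (1 + t / 2) / sqrt (1 + t)"
    proof -
      have "sqrt (1 + t) \<le> 1 + t / 2"
        using t by (intro real_le_lsqrt) (auto simp: power2_eq_square field_simps)
      then show ?thesis using t by simp
    qed
    also have "\<dots> = (1 - a / 2) * sqrt (1 + t)"
    proof -
      have "1 - a / 2 = (1 + t / 2) / (1 + t)" using t by (simp add: a_def field_simps)
      then show ?thesis using t real_sqrt_mult_self[of "1 + t"] by (simp add: field_simps)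
    qed
    finally have "1 \<le> sqrt ((1 - a / 2) * sqrt (1 + t))" by simp
    then have 1: "1 \<le> c * sqrt (1 - a / 2)" by (simp add: c_def real_sqrt_mult mult.commute)
    have "a / 2 / (2 * (1 - a / 2)) * u\<^sup>2 \<le> 1 / 2 * u\<^sup>2"
      using a by (intro mult_right_mono) (auto simp: field_simps)
    then have 2: "exp (a / 2 * u\<^sup>2 / (2 * (1 - a / 2))) \<le> exp (u\<^sup>2 / 2)" by simp
    have "1 / c * (exp (a / 2 * u\<^sup>2 / (2 * (1 - a / 2))) / sqrt (1 - a / 2)) =
        exp (a / 2 * u\<^sup>2 / (2 * (1 - a / 2))) / (c * sqrt (1 - a / 2))" by simp
    also have "\<dots> \<le> exp (a / 2 * u\<^sup>2 / (2 * (1 - a / 2))) / 1"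
      using 1 by (intro divide_left_mono) auto
    also have "\<dots> \<le> exp (u\<^sup>2 / 2)"
      unfolding div_by_1 by (rule 2)
    finally show "1 / c * (exp (a / 2 * u\<^sup>2 / (2 * (1 - a / 2))) / sqrt (1 - a / 2)) \<le> exp (u\<^sup>2 / 2)" .
  qed
  finally show ?thesis .
qed

lemma sqrt_n_observe: "n > 0 \<Longrightarrow> sqrt (real n) * observe n \<theta> \<xi> i = sqrt (real n) * \<theta> i + \<xi> i"
  by (simp add: observe_def field_simps)

text \<open>
  The weight of \<open>k\<close> is at most its ratio to the weight of \<open>l\<close>, in which the coordinates from \<open>k\<close> to \<open>l\<close>
  contribute inverse Bayes factors.
\<close>
lemma underfit_weight:
  assumes n: "n > 0" and kl: "k \<le> l" and l: "pmf \<kappa> l > 0"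
  shows "(\<integral>\<^sup>+\<xi>. dim_weight \<kappa> n s k (observe n \<theta> \<xi>) \<partial>std_noise) \<le>
    ennreal (pmf \<kappa> k / pmf \<kappa> l *
      (\<Prod>i\<in>{k..<l}. sqrt (1 + real n * (s i)\<^sup>2) * exp (- (shrink n (s i) * (real n * (\<theta> i)\<^sup>2) / 4))))"
proof -
  let ?t = "\<lambda>i. real n * (s i)\<^sup>2" and ?u = "\<lambda>i. sqrt (real n) * \<theta> i"
  have "(\<integral>\<^sup>+\<xi>. dim_weight \<kappa> n s k (observe n \<theta> \<xi>) \<partial>std_noise) \<le>
     (\<integral>\<^sup>+\<xi>. ennreal (pmf \<kappa> k / pmf \<kappa> l) * (\<Prod>i\<in>{k..<l}. ennreal (1 / coord_bf (?t i) (?u i + \<xi> i))) \<partial>std_noise)"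
  proof (rule nn_integral_mono)
    fix \<xi>
    let ?x = "observe n \<theta> \<xi>"
    have "evidence n s k ?x / evidence n s l ?x = (\<Prod>i\<in>{k..<l}. 1 / coord_bf (?t i) (?u i + \<xi> i))"
      unfolding evidence_split[OF kl] using evidence_pos[of n s k ?x] n
      by (simp add: sqrt_n_observe prod_dividef)
    then show "dim_weight \<kappa> n s k ?x \<le>
        ennreal (pmf \<kappa> k / pmf \<kappa> l) * (\<Prod>i\<in>{k..<l}. ennreal (1 / coord_bf (?t i) (?u i + \<xi> i)))"
      using dim_weight_le_ratio[OF l, of n s k ?x]
      by (simp add: prod_ennreal coord_bf_pos less_imp_le ennreal_mult'[symmetric] prod_nonneg)
  qed
  also have "\<dots> = ennreal (pmf \<kappa> k / pmf \<kappa> l) *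
      (\<integral>\<^sup>+\<xi>. (\<Prod>i\<in>{k..<l}. ennreal (1 / coord_bf (?t i) (?u i + \<xi> i))) \<partial>std_noise)"
    by (rule nn_integral_cmult) (unfold coord_bf_def, measurable)
  also have "\<dots> = ennreal (pmf \<kappa> k / pmf \<kappa> l) *
      (\<Prod>i\<in>{k..<l}. \<integral>\<^sup>+z. ennreal (1 / coord_bf (?t i) (?u i + z)) \<partial>gauss)"
    by (subst nn_integral_std_noise_prod[where f="\<lambda>i z. ennreal (1 / coord_bf (?t i) (?u i + z))"])
       (auto simp: coord_bf_def)
  also have "\<dots> \<le> ennreal (pmf \<kappa> k / pmf \<kappa> l) *
      (\<Prod>i\<in>{k..<l}. ennreal (sqrt (1 + ?t i) * exp (- (?t i / (1 + ?t i) * (?u i)\<^sup>2 / 4))))"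
    by (intro mult_left_mono prod_mono_ennreal gauss_inverse_coord_bf) auto
  also have "\<dots> = ennreal (pmf \<kappa> k / pmf \<kappa> l *
      (\<Prod>i\<in>{k..<l}. sqrt (1 + ?t i) * exp (- (shrink n (s i) * (real n * (\<theta> i)\<^sup>2) / 4))))"
    by (subst prod_ennreal) (auto simp: ennreal_mult'[symmetric] prod_nonneg shrink_def power_mult_distrib)
  finally show ?thesis .
qed

lemma ennreal_le_sqrt:
  assumes "w \<le> 1" "w \<le> ennreal r"
  shows "w \<le> ennreal (sqrt r)"
proof (cases "r \<ge> 1")
  case True
  then have "ennreal 1 \<le> ennreal (sqrt r)" by (intro ennreal_leI) simp
  with assms(1) show ?thesis by (metis ennreal_1 order_trans)
next
  case False
  show ?thesis
  proof (cases "r \<le> 0")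
    case True
    then have "ennreal r = 0" by (rule ennreal_neg)
    then show ?thesis using assms(2) by simp
  next
    case r: False
    have "r\<^sup>2 \<le> r" using False r by (simp add: power2_eq_square mult_left_le)
    then have "r \<le> sqrt r" by (rule real_le_rsqrt)
    then show ?thesis using assms(2) ennreal_leI order_trans by blast
  qed
qed

text \<open>
  Here the ratio to the weight of \<open>l\<close> is a product of Bayes factors, and \<open>ennreal_le_sqrt\<close> allows its square root
  to be used in place of it.
\<close>
lemma overfit_weight:
  assumes n: "n > 0" and lk: "l \<le> k" and l: "pmf \<kappa> l > 0"
  shows "(\<integral>\<^sup>+\<xi>. dim_weight \<kappa> n s k (observe n \<theta> \<xi>) \<partial>std_noise) \<le>
    ennreal (sqrt (pmf \<kappa> k / pmf \<kappa> l) * exp (real n * (\<Sum>i\<in>{l..<k}. (\<theta> i)\<^sup>2) / 2))"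
proof -
  let ?t = "\<lambda>i. real n * (s i)\<^sup>2" and ?u = "\<lambda>i. sqrt (real n) * \<theta> i"
  have "(\<integral>\<^sup>+\<xi>. dim_weight \<kappa> n s k (observe n \<theta> \<xi>) \<partial>std_noise) \<le>
     (\<integral>\<^sup>+\<xi>. ennreal (sqrt (pmf \<kappa> k / pmf \<kappa> l)) *
        (\<Prod>i\<in>{l..<k}. ennreal (sqrt (coord_bf (?t i) (?u i + \<xi> i)))) \<partial>std_noise)"
  proof (rule nn_integral_mono)
    fix \<xi>
    let ?x = "observe n \<theta> \<xi>"
    have "evidence n s k ?x / evidence n s l ?x = (\<Prod>i\<in>{l..<k}. coord_bf (?t i) (?u i + \<xi> i))"
      unfolding evidence_split[OF lk] using evidence_pos[of n s l ?x] n
      by (simp add: sqrt_n_observe)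
    then have "dim_weight \<kappa> n s k ?x \<le>
        ennreal (pmf \<kappa> k / pmf \<kappa> l * (\<Prod>i\<in>{l..<k}. coord_bf (?t i) (?u i + \<xi> i)))"
      using dim_weight_le_ratio[OF l, of n s k ?x] by simp
    from ennreal_le_sqrt[OF dim_weight_le_1 this, unfolded real_sqrt_mult sqrt_prod]
    show "dim_weight \<kappa> n s k ?x \<le> ennreal (sqrt (pmf \<kappa> k / pmf \<kappa> l)) *
        (\<Prod>i\<in>{l..<k}. ennreal (sqrt (coord_bf (?t i) (?u i + \<xi> i))))"
      by (subst prod_ennreal) (simp_all add: coord_bf_pos less_imp_le ennreal_mult' flip: real_sqrt_divide)
  qed
  also have "\<dots> = ennreal (sqrt (pmf \<kappa> k / pmf \<kappa> l)) *
      (\<integral>\<^sup>+\<xi>. (\<Prod>i\<in>{l..<k}. ennreal (sqrt (coord_bf (?t i) (?u i + \<xi> i)))) \<partial>std_noise)"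
    by (rule nn_integral_cmult) (unfold coord_bf_def, measurable)
  also have "\<dots> = ennreal (sqrt (pmf \<kappa> k / pmf \<kappa> l)) *
      (\<Prod>i\<in>{l..<k}. \<integral>\<^sup>+z. ennreal (sqrt (coord_bf (?t i) (?u i + z))) \<partial>gauss)"
    by (subst nn_integral_std_noise_prod[where f="\<lambda>i z. ennreal (sqrt (coord_bf (?t i) (?u i + z)))"])
       (auto simp: coord_bf_def)
  also have "\<dots> \<le> ennreal (sqrt (pmf \<kappa> k / pmf \<kappa> l)) * (\<Prod>i\<in>{l..<k}. ennreal (exp ((?u i)\<^sup>2 / 2)))"
    by (intro mult_left_mono prod_mono_ennreal gauss_sqrt_coord_bf) auto
  also have "(\<Prod>i\<in>{l..<k}. ennreal (exp ((?u i)\<^sup>2 / 2))) = ennreal (exp (real n * (\<Sum>i\<in>{l..<k}. (\<theta> i)\<^sup>2) / 2))"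
    by (subst prod_ennreal) (auto simp: exp_sum[symmetric] power_mult_distrib sum_distrib_left sum_divide_distrib)
  finally show ?thesis by (simp add: ennreal_mult')
qed

section \<open>The risk in terms of the weights\<close>

text \<open>
  The error of the posterior mean splits into the bias \<open>(1 - a) \<theta>\<close> and the noise \<open>a \<xi> / sqrt n\<close>, with \<open>a \<le> 1\<close>.
\<close>
lemma coord_risk_observe_le:
  assumes n: "n > 0"
  shows "coord_risk n \<sigma> (\<theta> i) (observe n \<theta> \<xi> i) \<le>
    2 * (1 - shrink n \<sigma>) * (\<theta> i)\<^sup>2 + (2 * (\<xi> i)\<^sup>2 + 1) / real n"
proof -
  define a where "a = shrink n \<sigma>"
  have a: "0 \<le> a" "a \<le> 1" by (auto simp: a_def shrink_def divide_le_eq_1 add_pos_nonneg)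
  have a2: "a\<^sup>2 \<le> 1" "(1 - a)\<^sup>2 \<le> 1 - a"
    using a by (auto simp: power2_eq_square mult_le_one mult_left_le)
  define e where "e = \<xi> i / sqrt (real n)"
  have e2: "e\<^sup>2 = (\<xi> i)\<^sup>2 / real n" by (simp add: e_def power_divide)
  have "(a * (\<theta> i + e) - \<theta> i)\<^sup>2 \<le> 2 * ((1 - a)\<^sup>2 * (\<theta> i)\<^sup>2) + 2 * (a\<^sup>2 * e\<^sup>2)"
  proof -
    have "2 * ((1 - a)\<^sup>2 * (\<theta> i)\<^sup>2) + 2 * (a\<^sup>2 * e\<^sup>2) - (a * (\<theta> i + e) - \<theta> i)\<^sup>2 = ((1 - a) * \<theta> i + a * e)\<^sup>2"
      by (simp add: power2_eq_square algebra_simps)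
    then show ?thesis by (smt (verit) zero_le_power2)
  qed
  also have "\<dots> \<le> 2 * ((1 - a) * (\<theta> i)\<^sup>2) + 2 * (1 * e\<^sup>2)"
    using a2 by (intro add_mono mult_left_mono mult_right_mono) auto
  finally have "(a * (\<theta> i + e) - \<theta> i)\<^sup>2 \<le> 2 * (1 - a) * (\<theta> i)\<^sup>2 + 2 * (\<xi> i)\<^sup>2 / real n"
    by (simp only: e2 mult_1 mult.assoc times_divide_eq_right)
  moreover have "a / real n \<le> 1 / real n" using a n by (intro divide_right_mono) auto
  ultimately show ?thesis
    by (simp add: coord_risk_def a_def observe_def e_def add_divide_distrib)
qed

lemma tail_energy_split:
  assumes "\<theta> \<in> l2" "k \<le> l"
  shows "tail_energy k \<theta> = (\<Sum>i\<in>{k..<l}. (\<theta> i)\<^sup>2) + tail_energy l \<theta>"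
proof -
  have "summable (\<lambda>i. (\<theta> (i + k))\<^sup>2)"
    using assms(1) unfolding l2_def by (intro summable_ignore_initial_segment) simp
  from suminf_split_initial_segment[OF this, of "l - k"]
  have "tail_energy k \<theta> = tail_energy l \<theta> + (\<Sum>i<l - k. (\<theta> (i + k))\<^sup>2)"
    using assms(2) by (simp add: tail_energy_def add.assoc)
  also have "(\<Sum>i<l - k. (\<theta> (i + k))\<^sup>2) = (\<Sum>i\<in>{k..<l}. (\<theta> i)\<^sup>2)"
    by (rule sum.reindex_bij_witness[of _ "\<lambda>i. i - k" "\<lambda>i. i + k"]) auto
  finally show ?thesis by simp
qed

text \<open>
  The weights depend on the noise, so their product with the squared noise has no product expectation. The
  inequality of arithmetic and geometric means decouples them; the factors \<open>4 ^ k\<close> are affordable because the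
  weights of large dimensions decay faster and the factors \<open>(1/4) ^ k\<close> make the fourth moments summable.
\<close>
lemma weighted_le_quartic:
  fixes w v :: real
  assumes "0 \<le> w" "w \<le> 1"
  shows "w * v \<le> 4 ^ k * w + (1/4) ^ k * v\<^sup>2"
proof -
  define c :: real where "c = 2 ^ k"
  have c: "c > 0" by (simp add: c_def)
  have c2: "(4::real) ^ k = c\<^sup>2" "(1/4::real) ^ k = (1 / c)\<^sup>2"
    by (simp_all add: c_def power_mult[symmetric] mult.commute[of k] power_one_over)
       (simp_all add: power_mult)
  have "0 \<le> (c * w - 1 / c * v)\<^sup>2" by simp
  also have "\<dots> = c\<^sup>2 * w\<^sup>2 + (1 / c)\<^sup>2 * v\<^sup>2 - 2 * (w * v)"
    using c by (simp add: power2_eq_square field_simps)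
  finally have "2 * (w * v) \<le> c\<^sup>2 * w\<^sup>2 + (1 / c)\<^sup>2 * v\<^sup>2" by simp
  moreover have "c\<^sup>2 * w\<^sup>2 \<le> c\<^sup>2 * w"
    using assms by (intro mult_left_mono) (auto simp: power2_eq_square mult_left_le)
  moreover have "0 \<le> c\<^sup>2 * w" "0 \<le> (1 / c)\<^sup>2 * v\<^sup>2" using assms by auto
  ultimately show ?thesis unfolding c2 by linarith
qed

lemma mult_exp_neg_le:
  fixes b c :: real
  assumes "c > 0"
  shows "b * exp (- (c * b)) \<le> 1 / c"
proof -
  have "c * b \<le> exp (c * b)" using exp_ge_add_one_self[of "c * b"] by linarith
  then show ?thesis using assms by (simp add: exp_minus field_simps)
qed

text \<open>
  The contribution of dimension \<open>k\<close> with weight \<open>w\<close>. The first part is the cost of the dimensions between \<open>l\<close> and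
  \<open>K\<close> with a tolerance \<open>A\<close>; it is linear in \<open>w\<close>, so summing over \<open>k\<close> with weights of total mass at most \<open>1\<close> costs
  nothing. The other parts are present only for dimensions missing more than \<open>A\<close> of the energy below \<open>l\<close>, and for
  dimensions above \<open>K\<close>.
\<close>
lemma weighted_risk_le:
  fixes w :: real
  assumes n: "n > 0" and \<theta>: "\<theta> \<in> l2" and K: "l \<le> K" and A: "A \<ge> 0" and w: "0 \<le> w" "w \<le> 1"
  shows "w * ((\<Sum>i<k. coord_risk n (s i) (\<theta> i) (observe n \<theta> \<xi> i)) + tail_energy k \<theta>) \<le>
    w * ((\<Sum>i<K. 2 * (1 - shrink n (s i)) * (\<theta> i)\<^sup>2 + (2 * (\<xi> i)\<^sup>2 + 1) / real n) + 3 * tail_energy l \<theta> + A)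
    + (if k < l \<and> A < (\<Sum>i\<in>{k..<l}. (\<theta> i)\<^sup>2) then (\<Sum>i\<in>{k..<l}. (\<theta> i)\<^sup>2) * w else 0)
    + (if K < k then real k * 4 ^ k / real n * w + (\<Sum>i<k. (1/4) ^ k / real n * (2 * (\<xi> i)\<^sup>2 + 1)\<^sup>2) else 0)"
proof -
  define b where "b = (\<Sum>i\<in>{k..<l}. (\<theta> i)\<^sup>2)"
  define T where "T = tail_energy l \<theta>"
  define d where "d i = 2 * (1 - shrink n (s i)) * (\<theta> i)\<^sup>2 + (2 * (\<xi> i)\<^sup>2 + 1) / real n" for i
  define q where "q = (if K < k then real k * 4 ^ k / real n * w + (\<Sum>i<k. (1/4) ^ k / real n * (2 * (\<xi> i)\<^sup>2 + 1)\<^sup>2) else 0)"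
  have T: "T \<ge> 0" unfolding T_def by (rule tail_energy_nonneg[OF \<theta>])
  have sh: "shrink n (s i) \<le> 1" for i by (auto simp: shrink_def divide_le_eq_1 add_pos_nonneg)
  have d0: "d i \<ge> 0" for i unfolding d_def using sh[of i] by (intro add_nonneg_nonneg mult_nonneg_nonneg) auto
  have tail: "w * tail_energy k \<theta> \<le> w * (T + A) + (if k < l \<and> A < b then b * w else 0)"
  proof (cases "k < l")
    case True
    then have "tail_energy k \<theta> = b + T"
      using tail_energy_split[OF \<theta>, of k l] by (simp add: b_def T_def)
    moreover have "w * b \<le> w * A" if "\<not> A < b" using that w by (intro mult_left_mono) auto
    moreover have "w * A \<ge> 0" using w A by simp
    ultimately show ?thesis using True by (auto simp: algebra_simps)
  next
    case False
    then have "tail_energy k \<theta> \<le> T"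
      using tail_energy_split[OF \<theta>, of l k] by (simp add: T_def sum_nonneg)
    then have "w * tail_energy k \<theta> \<le> w * (T + A)" using w A by (intro mult_left_mono) auto
    then show ?thesis using False by simp
  qed
  have "(\<Sum>i<k. coord_risk n (s i) (\<theta> i) (observe n \<theta> \<xi> i)) \<le> (\<Sum>i<k. d i)"
    unfolding d_def by (intro sum_mono coord_risk_observe_le n)
  then have "w * (\<Sum>i<k. coord_risk n (s i) (\<theta> i) (observe n \<theta> \<xi> i)) \<le> w * (\<Sum>i<k. d i)"
    using w by (intro mult_left_mono) auto
  also have "\<dots> \<le> w * ((\<Sum>i<K. d i) + 2 * T) + q"
  proof (cases "K < k")
    case False
    then have "(\<Sum>i<k. d i) \<le> (\<Sum>i<K. d i)" using d0 by (intro sum_mono2) auto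
    then have "w * (\<Sum>i<k. d i) \<le> w * ((\<Sum>i<K. d i) + 2 * T)" using w T by (intro mult_left_mono) auto
    then show ?thesis using False by (simp add: q_def)
  next
    case True
    have "{..<k} = {..<K} \<union> {K..<k}" using True by auto
    then have "(\<Sum>i<k. d i) = (\<Sum>i<K. d i) + (\<Sum>i\<in>{K..<k}. d i)"
      by (simp add: sum.union_disjoint ivl_disj_int)
    also have "(\<Sum>i\<in>{K..<k}. d i) \<le> (\<Sum>i\<in>{K..<k}. 2 * (\<theta> i)\<^sup>2 + (2 * (\<xi> i)\<^sup>2 + 1) / real n)"
      unfolding d_def
    proof (intro sum_mono add_right_mono)
      fix i show "2 * (1 - shrink n (s i)) * (\<theta> i)\<^sup>2 \<le> 2 * (\<theta> i)\<^sup>2"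
        using shrink_nonneg[of n "s i"] by (intro mult_right_mono) auto
    qed
    also have "\<dots> = 2 * (\<Sum>i\<in>{K..<k}. (\<theta> i)\<^sup>2) + (\<Sum>i\<in>{K..<k}. (2 * (\<xi> i)\<^sup>2 + 1) / real n)"
      by (simp add: sum.distrib sum_distrib_left)
    also have "(\<Sum>i\<in>{K..<k}. (\<theta> i)\<^sup>2) \<le> T"
    proof -
      have "tail_energy K \<theta> \<le> T"
        using tail_energy_split[OF \<theta> K] by (simp add: T_def sum_nonneg)
      moreover have "(\<Sum>i\<in>{K..<k}. (\<theta> i)\<^sup>2) \<le> tail_energy K \<theta>"
        using tail_energy_split[OF \<theta>, of K k] True tail_energy_nonneg[OF \<theta>, of k] by simp
      ultimately show ?thesis by linarith
    qed
    also have "(\<Sum>i\<in>{K..<k}. (2 * (\<xi> i)\<^sup>2 + 1) / real n) \<le> (\<Sum>i<k. (2 * (\<xi> i)\<^sup>2 + 1) / real n)"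
      by (intro sum_mono2) auto
    finally have "(\<Sum>i<k. d i) \<le> (\<Sum>i<K. d i) + (2 * T + (\<Sum>i<k. (2 * (\<xi> i)\<^sup>2 + 1) / real n))" by simp
    then have "w * (\<Sum>i<k. d i) \<le> w * ((\<Sum>i<K. d i) + (2 * T + (\<Sum>i<k. (2 * (\<xi> i)\<^sup>2 + 1) / real n)))"
      using w(1) by (rule mult_left_mono)
    also have "\<dots> = w * ((\<Sum>i<K. d i) + 2 * T) + (\<Sum>i<k. w * (2 * (\<xi> i)\<^sup>2 + 1) / real n)"
      by (simp add: algebra_simps sum_distrib_left)
    also have "(\<Sum>i<k. w * (2 * (\<xi> i)\<^sup>2 + 1) / real n) \<le>
        (\<Sum>i<k. (4 ^ k * w + (1/4) ^ k * (2 * (\<xi> i)\<^sup>2 + 1)\<^sup>2) / real n)"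
      using w by (intro sum_mono divide_right_mono weighted_le_quartic) auto
    also have "\<dots> = q"
      using True by (simp add: q_def add_divide_distrib sum.distrib)
    finally show ?thesis by simp
  qed
  finally have "w * (\<Sum>i<k. coord_risk n (s i) (\<theta> i) (observe n \<theta> \<xi> i)) \<le> w * ((\<Sum>i<K. d i) + 2 * T) + q" .
  with tail show ?thesis
    unfolding d_def[symmetric] T_def[symmetric] b_def[symmetric] q_def[symmetric]
    by (simp add: algebra_simps)
qed

text \<open>
  The risk is at most the cost of the dimensions between \<open>l\<close> and \<open>K\<close>, up to \<open>A\<close> and \<open>O(l / n)\<close>, as soon as the
  dimensions that miss much energy and the dimensions above \<open>K\<close> have exponentially small expected weights.
\<close>
lemma sieve_risk_bound:
  assumes n: "n > 0" and \<theta>: "\<theta> \<in> l2" and K: "l \<le> K" and A: "A \<ge> 0"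
    and under: "\<And>k. k < l \<Longrightarrow> A < (\<Sum>i\<in>{k..<l}. (\<theta> i)\<^sup>2) \<Longrightarrow>
       (\<integral>\<^sup>+\<xi>. dim_weight \<kappa> n s k (observe n \<theta> \<xi>) \<partial>std_noise)
         \<le> ennreal (exp (- (real n / 8 * (\<Sum>i\<in>{k..<l}. (\<theta> i)\<^sup>2))))"
    and over: "\<And>k. K < k \<Longrightarrow>
       (\<integral>\<^sup>+\<xi>. dim_weight \<kappa> n s k (observe n \<theta> \<xi>) \<partial>std_noise) \<le> ennreal ((1/16) ^ k)"
  shows "(\<integral>\<^sup>+x. (\<Sum>k. dim_weight \<kappa> n s k x *
       ennreal ((\<Sum>i<k. coord_risk n (s i) (\<theta> i) (x i)) + tail_energy k \<theta>)) \<partial>wn_law n \<theta>) \<le>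
    ennreal ((\<Sum>i<K. 2 * (1 - shrink n (s i)) * (\<theta> i)\<^sup>2) + 3 * tail_energy l \<theta> + A +
       (3 * real K + 8 * real l + 36) / real n)"
proof -
  define W where "W k \<xi> = dim_weight \<kappa> n s k (observe n \<theta> \<xi>)" for k \<xi>
  have [measurable]: "W k \<in> borel_measurable std_noise" for k
    unfolding W_def by measurable
  define v where "v i \<xi> = 2 * (\<xi> i)\<^sup>2 + 1" for i and \<xi> :: "nat \<Rightarrow> real"
  have [measurable]: "v i \<in> borel_measurable std_noise" for i
    unfolding v_def by measurable
  have v0: "v i \<xi> \<ge> 0" for i \<xi> by (simp add: v_def)
  define T where "T = tail_energy l \<theta>"
  have T: "T \<ge> 0" unfolding T_def by (rule tail_energy_nonneg[OF \<theta>])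
  define a where "a i = 2 * (1 - shrink n (s i)) * (\<theta> i)\<^sup>2" for i
  have a0: "a i \<ge> 0" for i unfolding a_def
    by (intro mult_nonneg_nonneg) (auto simp: shrink_def divide_le_eq_1 add_pos_nonneg)
  define b where "b k = (\<Sum>i\<in>{k..<l}. (\<theta> i)\<^sup>2)" for k
  have b0: "b k \<ge> 0" for k by (simp add: b_def sum_nonneg)
  \<comment> \<open>The cost common to all dimensions, and below it the excess of the bad ones.\<close>
  define G where "G \<xi> = (\<Sum>i<K. a i + v i \<xi> / real n) + 3 * T + A" for \<xi>
  have [measurable]: "G \<in> borel_measurable std_noise" unfolding G_def by measurable
  have G0: "G \<xi> \<ge> 0" for \<xi>
    unfolding G_def
    by (intro add_nonneg_nonneg sum_nonneg divide_nonneg_nonneg mult_nonneg_nonneg a0 v0 T A) auto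
  define R where "R k \<xi> = (if k < l \<and> A < b k then ennreal (b k) * W k \<xi> else 0) +
     (if K < k then ennreal (real k * 4 ^ k / real n) * W k \<xi> +
        (\<Sum>i<k. ennreal ((1/4) ^ k / real n * (v i \<xi>)\<^sup>2)) else 0)" for k \<xi>
  have [measurable]: "R k \<in> borel_measurable std_noise" for k
    unfolding R_def by measurable
  let ?C = "\<lambda>k x. ennreal ((\<Sum>i<k. coord_risk n (s i) (\<theta> i) (x i)) + tail_energy k \<theta>)"
  have summand: "W k \<xi> * ?C k (observe n \<theta> \<xi>) \<le> W k \<xi> * ennreal (G \<xi>) + R k \<xi>" for k \<xi>
  proof -
    have W1: "W k \<xi> \<le> 1" unfolding W_def by (rule dim_weight_le_1)
    then have "W k \<xi> < top" using ennreal_one_less_top le_less_trans by blast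
    then obtain w where w: "w \<ge> 0" "W k \<xi> = ennreal w" by (cases "W k \<xi>") auto
    with W1 have w1: "w \<le> 1" by simp
    let ?u = "if k < l \<and> A < b k then b k * w else 0"
    let ?o = "if K < k then real k * 4 ^ k / real n * w + (\<Sum>i<k. (1/4) ^ k / real n * (v i \<xi>)\<^sup>2) else 0"
    have uo: "0 \<le> ?u" "0 \<le> ?o"
      using w b0 by (auto intro!: add_nonneg_nonneg sum_nonneg mult_nonneg_nonneg)
    have "W k \<xi> * ?C k (observe n \<theta> \<xi>) \<le> ennreal (w * G \<xi> + ?u + ?o)"
      unfolding w(2) ennreal_mult'[OF w(1), symmetric] G_def a_def b_def v_def T_def
      by (intro ennreal_leI weighted_risk_le n \<theta> K A w w1)
    also have "\<dots> = ennreal (w * G \<xi>) + (ennreal ?u + ennreal ?o)"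
      using uo w G0 by (simp only: ennreal_plus mult_nonneg_nonneg add_nonneg_nonneg add.assoc)
    also have "ennreal (w * G \<xi>) = W k \<xi> * ennreal (G \<xi>)"
      using w by (simp add: ennreal_mult')
    also have "ennreal ?u + ennreal ?o = R k \<xi>"
      using w b0 ennreal_mult''[OF w(1), of "real k * 4 ^ k / real n"] by (auto simp: R_def ennreal_plus ennreal_mult' sum_nonneg sum_ennreal[symmetric] simp del: sum_ennreal)
    finally show ?thesis .
  qed
  have R: "(\<integral>\<^sup>+\<xi>. R k \<xi> \<partial>std_noise) \<le> ennreal ((if k < l then 8 / real n else 0) + 18 / real n * (1/2) ^ k)" for k
  proof -
    have kk: "real k \<le> 2 ^ k" using of_nat_less_two_power[of k, where 'a=real] by simp
    have u: "(\<integral>\<^sup>+\<xi>. (if k < l \<and> A < b k then ennreal (b k) * W k \<xi> else 0) \<partial>std_noise)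
        \<le> ennreal (if k < l then 8 / real n else 0)"
    proof (cases "k < l \<and> A < b k")
      case True
      then have "(\<integral>\<^sup>+\<xi>. (if k < l \<and> A < b k then ennreal (b k) * W k \<xi> else 0) \<partial>std_noise) =
          ennreal (b k) * (\<integral>\<^sup>+\<xi>. W k \<xi> \<partial>std_noise)"
        by (simp add: nn_integral_cmult)
      also have "\<dots> \<le> ennreal (b k) * ennreal (exp (- (real n / 8 * b k)))"
        unfolding W_def b_def using under True by (intro mult_left_mono) (auto simp: b_def)
      also have "\<dots> = ennreal (b k * exp (- (real n / 8 * b k)))"
        using b0 by (simp add: ennreal_mult')
      also have "\<dots> \<le> ennreal (8 / real n)"
        using mult_exp_neg_le[of "real n / 8" "b k"] n by (intro ennreal_leI) simp
      finally show ?thesis using True by simp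
    qed auto
    have ov: "(\<integral>\<^sup>+\<xi>. (if K < k then ennreal (real k * 4 ^ k / real n) * W k \<xi> +
        (\<Sum>i<k. ennreal ((1/4) ^ k / real n * (v i \<xi>)\<^sup>2)) else 0) \<partial>std_noise) \<le> ennreal (18 / real n * (1/2) ^ k)"
    proof (cases "K < k")
      case True
      have m4: "(\<integral>\<^sup>+\<xi>. ennreal ((1/4) ^ k / real n * (v i \<xi>)\<^sup>2) \<partial>std_noise) = ennreal ((1/4) ^ k / real n * 17)" for i
      proof -
        have "(\<integral>\<^sup>+\<xi>. ennreal ((1/4) ^ k / real n * (v i \<xi>)\<^sup>2) \<partial>std_noise) =
            ennreal ((1/4) ^ k / real n) * (\<integral>\<^sup>+\<xi>. ennreal ((2 * (\<xi> i)\<^sup>2 + 1)\<^sup>2) \<partial>std_noise)"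
          unfolding v_def by (subst nn_integral_cmult[symmetric]) (auto simp: ennreal_mult'[symmetric])
        also have "(\<integral>\<^sup>+\<xi>. ennreal ((2 * (\<xi> i)\<^sup>2 + 1)\<^sup>2) \<partial>std_noise) = 17"
          by (subst nn_integral_std_noise_coord[where f="\<lambda>z. ennreal ((2 * z\<^sup>2 + 1)\<^sup>2)"])
             (auto simp: gauss_quartic_mean)
        finally show ?thesis by (simp only: ennreal_mult'' ennreal_numeral zero_le_numeral)
      qed
      have s4: "(\<integral>\<^sup>+\<xi>. (\<Sum>i<k. ennreal ((1/4) ^ k / real n * (v i \<xi>)\<^sup>2)) \<partial>std_noise) =
          (\<Sum>i<k. ennreal ((1/4) ^ k / real n * 17))"
        by (subst nn_integral_sum) (measurable, simp only: m4)
      have cW: "(\<integral>\<^sup>+\<xi>. ennreal (real k * 4 ^ k / real n) * W k \<xi> \<partial>std_noise) =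
          ennreal (real k * 4 ^ k / real n) * (\<integral>\<^sup>+\<xi>. W k \<xi> \<partial>std_noise)"
        by (rule nn_integral_cmult) measurable
      have "(\<integral>\<^sup>+\<xi>. (if K < k then ennreal (real k * 4 ^ k / real n) * W k \<xi> +
        (\<Sum>i<k. ennreal ((1/4) ^ k / real n * (v i \<xi>)\<^sup>2)) else 0) \<partial>std_noise) =
         ennreal (real k * 4 ^ k / real n) * (\<integral>\<^sup>+\<xi>. W k \<xi> \<partial>std_noise) + (\<Sum>i<k. ennreal ((1/4) ^ k / real n * 17))"
        using True by (simp only: if_True) (subst nn_integral_add, measurable, simp only: s4 cW)
      also have "\<dots> \<le> ennreal (real k * 4 ^ k / real n) * ennreal ((1/16) ^ k) + (\<Sum>i<k. ennreal ((1/4) ^ k / real n * 17))"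
        unfolding W_def using over[OF True] by (intro add_mono mult_left_mono) auto
      also have "\<dots> = ennreal (real k * 4 ^ k / real n * (1/16) ^ k + (\<Sum>i<k. (1/4) ^ k / real n * 17))"
        using ennreal_mult''[of "(1/16) ^ k" "real k * 4 ^ k / real n"]
        by (subst ennreal_plus) (auto simp: sum_ennreal[symmetric] intro!: sum_nonneg simp del: sum_ennreal sum_constant)
      also have "\<dots> \<le> ennreal (18 / real n * (1/2) ^ k)"
      proof (rule ennreal_leI)
        have e: "4 ^ k * (1/16::real) ^ k = (1/4) ^ k" by (simp add: power_mult_distrib[symmetric])
        have "real k * 4 ^ k / real n * (1/16) ^ k + (\<Sum>i<k. (1/4) ^ k / real n * 17) =
            real k * (4 ^ k * (1/16) ^ k) / real n + real k * (1/4) ^ k * 17 / real n" by simp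
        also have "\<dots> = 18 / real n * (real k * (1/4) ^ k)" unfolding e by (simp add: field_simps)
        also have "\<dots> \<le> 18 / real n * (2 ^ k * (1/4) ^ k)"
          using kk by (intro mult_left_mono mult_right_mono) auto
        also have "2 ^ k * (1/4::real) ^ k = (1/2) ^ k" by (simp add: power_mult_distrib[symmetric])
        finally show "real k * 4 ^ k / real n * (1/16) ^ k + (\<Sum>i<k. (1/4) ^ k / real n * 17) \<le> 18 / real n * (1/2) ^ k" .
      qed
      finally show ?thesis .
    qed auto
    have "(\<integral>\<^sup>+\<xi>. R k \<xi> \<partial>std_noise) \<le> ennreal (if k < l then 8 / real n else 0) + ennreal (18 / real n * (1/2) ^ k)"
      unfolding R_def by (subst nn_integral_add) (measurable, intro add_mono u ov)
    then show ?thesis by (subst ennreal_plus) auto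
  qed
  have sumR: "(\<Sum>k. \<integral>\<^sup>+\<xi>. R k \<xi> \<partial>std_noise) \<le> ennreal ((8 * real l + 36) / real n)"
  proof -
    have "(\<lambda>k. if k \<in> {..<l} then 8 / real n else 0) sums (\<Sum>k<l. 8 / real n)"
      by (rule sums_If_finite_set) simp
    moreover have "(\<lambda>k. 18 / real n * (1/2) ^ k) sums (18 / real n * (1 / (1 - 1/2)))"
      by (intro sums_mult geometric_sums) simp
    ultimately have "(\<lambda>k. (if k \<in> {..<l} then 8 / real n else 0) + 18 / real n * (1/2) ^ k) sums
        ((\<Sum>k<l. 8 / real n) + 18 / real n * (1 / (1 - 1/2)))"
      by (rule sums_add)
    then have sm: "(\<lambda>k. (if k < l then 8 / real n else 0) + 18 / real n * (1/2) ^ k) sums ((8 * real l + 36) / real n)"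
      by (simp add: add_divide_distrib mult.commute)
    have "(\<Sum>k. \<integral>\<^sup>+\<xi>. R k \<xi> \<partial>std_noise) \<le>
        (\<Sum>k. ennreal ((if k < l then 8 / real n else 0) + 18 / real n * (1/2) ^ k))"
      by (intro suminf_le R) auto
    also have "\<dots> = ennreal ((8 * real l + 36) / real n)"
      using sums_unique[OF sm] sums_summable[OF sm] by (subst suminf_ennreal2) auto
    finally show ?thesis .
  qed
  have intG: "(\<integral>\<^sup>+\<xi>. ennreal (G \<xi>) \<partial>std_noise) = ennreal ((\<Sum>i<K. a i) + 3 * T + A + 3 * real K / real n)"
  proof -
    have m2: "(\<integral>\<^sup>+\<xi>. ennreal (v i \<xi> / real n) \<partial>std_noise) = ennreal (3 / real n)" for i
    proof -
      have "(\<integral>\<^sup>+\<xi>. ennreal (v i \<xi> / real n) \<partial>std_noise) =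
          ennreal (1 / real n) * (\<integral>\<^sup>+\<xi>. ennreal (2 * (\<xi> i)\<^sup>2 + 1) \<partial>std_noise)"
        unfolding v_def
        by (subst nn_integral_cmult[symmetric]) (auto simp: ennreal_mult'[symmetric] simp del: ennreal_plus)
      also have "(\<integral>\<^sup>+\<xi>. ennreal (2 * (\<xi> i)\<^sup>2 + 1) \<partial>std_noise) = ennreal 3"
        by (subst nn_integral_std_noise_coord[where f="\<lambda>z. ennreal (2 * z\<^sup>2 + 1)"])
           (auto simp: gauss_quadratic_mean simp del: ennreal_plus)
      also have "ennreal (1 / real n) * ennreal 3 = ennreal (3 / real n)"
        by (subst ennreal_mult'[symmetric]) auto
      finally show ?thesis .
    qed
    have "(\<integral>\<^sup>+\<xi>. ennreal (G \<xi>) \<partial>std_noise) =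
        (\<integral>\<^sup>+\<xi>. ennreal ((\<Sum>i<K. a i) + 3 * T + A) + (\<Sum>i<K. ennreal (v i \<xi> / real n)) \<partial>std_noise)"
      using a0 v0 T A
      by (intro nn_integral_cong)
         (simp add: G_def sum.distrib sum_nonneg ennreal_plus[symmetric] algebra_simps del: ennreal_plus)
    also have "\<dots> = ennreal ((\<Sum>i<K. a i) + 3 * T + A) + (\<Sum>i<K. ennreal (3 / real n))"
      by (subst nn_integral_add) (auto simp: nn_integral_sum m2)
    also have "\<dots> = ennreal ((\<Sum>i<K. a i) + 3 * T + A + 3 * real K / real n)"
      using a0 T A by (subst sum_ennreal) (auto simp: sum_nonneg ennreal_plus[symmetric] algebra_simps simp del: ennreal_plus)
    finally show ?thesis .
  qed
  have "(\<integral>\<^sup>+x. (\<Sum>k. dim_weight \<kappa> n s k x * ?C k x) \<partial>wn_law n \<theta>) =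
      (\<integral>\<^sup>+\<xi>. (\<Sum>k. W k \<xi> * ?C k (observe n \<theta> \<xi>)) \<partial>std_noise)"
    unfolding W_def by (subst nn_integral_wn_law) (auto simp: coord_risk_def)
  also have "\<dots> \<le> (\<integral>\<^sup>+\<xi>. ennreal (G \<xi>) + (\<Sum>k. R k \<xi>) \<partial>std_noise)"
  proof (rule nn_integral_mono)
    fix \<xi>
    have "(\<Sum>k. W k \<xi> * ?C k (observe n \<theta> \<xi>)) \<le> (\<Sum>k. W k \<xi> * ennreal (G \<xi>) + R k \<xi>)"
      by (intro suminf_le summand) auto
    also have "\<dots> = (\<Sum>k. W k \<xi>) * ennreal (G \<xi>) + (\<Sum>k. R k \<xi>)"
      by (simp add: suminf_add[symmetric])
    also have "\<dots> \<le> 1 * ennreal (G \<xi>) + (\<Sum>k. R k \<xi>)"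
      unfolding W_def by (intro add_right_mono mult_right_mono dim_weight_suminf_le_1) auto
    finally show "(\<Sum>k. W k \<xi> * ?C k (observe n \<theta> \<xi>)) \<le> ennreal (G \<xi>) + (\<Sum>k. R k \<xi>)" by simp
  qed
  also have "\<dots> = (\<integral>\<^sup>+\<xi>. ennreal (G \<xi>) \<partial>std_noise) + (\<Sum>k. \<integral>\<^sup>+\<xi>. R k \<xi> \<partial>std_noise)"
    by (subst nn_integral_add) (auto simp: nn_integral_suminf)
  also have "\<dots> \<le> ennreal ((\<Sum>i<K. a i) + 3 * T + A + 3 * real K / real n) + ennreal ((8 * real l + 36) / real n)"
    unfolding intG by (intro add_left_mono sumR)
  also have "\<dots> = ennreal ((\<Sum>i<K. a i) + 3 * T + A + (3 * real K + 8 * real l + 36) / real n)"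
    using a0 T A by (subst ennreal_plus[symmetric]) (auto simp: sum_nonneg add_divide_distrib intro!: add_nonneg_nonneg)
  finally show ?thesis by (simp add: a_def T_def)
qed

section \<open>Sobolev classes and Poisson weights\<close>

lemma prior_scale_sq: "\<tau>0 > 0 \<Longrightarrow> (prior_scale \<tau>0 q i)\<^sup>2 = \<tau>0 * real (Suc i) powr (- 2 * q)"
  by (simp add: prior_scale_def)

lemma sobolev_class_l2:
  assumes "\<theta> \<in> sobolev_class \<beta> L" "\<beta> > 0"
  shows "\<theta> \<in> l2"
proof -
  have "summable (\<lambda>i. (\<theta> i)\<^sup>2)"
  proof (rule summable_comparison_test')
    show "summable (\<lambda>i. (\<theta> i)\<^sup>2 * real (Suc i) powr (2 * \<beta>))"
      using assms by (simp add: sobolev_class_def)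
    fix i
    have "1 \<le> real (Suc i) powr (2 * \<beta>)" using assms by (intro ge_one_powr_ge_zero) auto
    then have "(\<theta> i)\<^sup>2 * 1 \<le> (\<theta> i)\<^sup>2 * real (Suc i) powr (2 * \<beta>)" by (intro mult_left_mono) auto
    then show "norm ((\<theta> i)\<^sup>2) \<le> (\<theta> i)\<^sup>2 * real (Suc i) powr (2 * \<beta>)" by simp
  qed
  then show ?thesis by (simp add: l2_def)
qed

lemma sobolev_sum_le:
  assumes "\<theta> \<in> sobolev_class \<beta> L"
  shows "(\<Sum>i<K. (\<theta> i)\<^sup>2 * real (Suc i) powr (2 * \<beta>)) \<le> L"
proof -
  have "(\<Sum>i<K. (\<theta> i)\<^sup>2 * real (Suc i) powr (2 * \<beta>)) \<le> (\<Sum>i. (\<theta> i)\<^sup>2 * real (Suc i) powr (2 * \<beta>))"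
    using assms by (intro sum_le_suminf) (auto simp: sobolev_class_def)
  then show ?thesis using assms by (simp add: sobolev_class_def)
qed

lemma sobolev_tail_energy:
  assumes \<theta>: "\<theta> \<in> sobolev_class \<beta> L" and \<beta>: "\<beta> > 0" and k: "k \<ge> 1"
  shows "tail_energy k \<theta> \<le> L * real k powr (- 2 * \<beta>)"
proof -
  let ?f = "\<lambda>i. (\<theta> i)\<^sup>2 * real (Suc i) powr (2 * \<beta>)"
  have sm: "summable ?f" and sL: "suminf ?f < L" using \<theta> by (auto simp: sobolev_class_def)
  have smk: "summable (\<lambda>i. ?f (i + k))" by (rule summable_ignore_initial_segment[OF sm])
  have sm2: "summable (\<lambda>i. (\<theta> (i + k))\<^sup>2)"
    using sobolev_class_l2[OF \<theta> \<beta>] unfolding l2_def by (intro summable_ignore_initial_segment) simp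
  have "tail_energy k \<theta> \<le> (\<Sum>i. real k powr (- 2 * \<beta>) * ?f (i + k))"
    unfolding tail_energy_def
  proof (rule suminf_le[OF _ sm2 summable_mult[OF smk]])
    fix i
    have "1 = real k powr (- 2 * \<beta>) * real k powr (2 * \<beta>)"
      using k by (simp add: powr_add[symmetric])
    also have "\<dots> \<le> real k powr (- 2 * \<beta>) * real (Suc (i + k)) powr (2 * \<beta>)"
      using \<beta> by (intro mult_left_mono powr_mono2) auto
    finally have "(\<theta> (i + k))\<^sup>2 * 1 \<le>
        (\<theta> (i + k))\<^sup>2 * (real k powr (- 2 * \<beta>) * real (Suc (i + k)) powr (2 * \<beta>))"
      by (rule mult_left_mono) simp
    then show "(\<theta> (i + k))\<^sup>2 \<le> real k powr (- 2 * \<beta>) * ?f (i + k)" by (simp add: mult_ac)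
  qed
  also have "\<dots> = real k powr (- 2 * \<beta>) * (\<Sum>i. ?f (i + k))"
    by (rule suminf_mult[OF smk])
  also have "\<dots> \<le> real k powr (- 2 * \<beta>) * L"
    using suminf_split_initial_segment[OF sm, of k] sL sum_nonneg[of "{..<k}" ?f]
    by (intro mult_left_mono) auto
  finally show ?thesis by (simp add: mult.commute)
qed

text \<open>
  For \<open>i < K\<close> the prior weight \<open>(i + 1)^(2 q)\<close> exceeds the Sobolev weight by at most a factor \<open>i + 1 \<le> K\<close>. This covers
  the oversmoothing case \<open>\<beta> < q\<close> as well.
\<close>
lemma sobolev_prior_sum:
  assumes \<theta>: "\<theta> \<in> sobolev_class \<beta> L" and q: "2 * q \<le> 2 * \<beta> + 1"
  shows "(\<Sum>i<K. (\<theta> i)\<^sup>2 * real (Suc i) powr (2 * q)) \<le> L * real K"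
proof -
  have "(\<Sum>i<K. (\<theta> i)\<^sup>2 * real (Suc i) powr (2 * q)) \<le>
      (\<Sum>i<K. (\<theta> i)\<^sup>2 * real (Suc i) powr (2 * \<beta>) * real K)"
  proof (rule sum_mono)
    fix i assume "i \<in> {..<K}"
    have "real (Suc i) powr (2 * q) \<le> real (Suc i) powr (2 * \<beta> + 1)"
      using q by (intro powr_mono) auto
    also have "\<dots> = real (Suc i) powr (2 * \<beta>) * real (Suc i)" by (simp add: powr_add)
    also have "\<dots> \<le> real (Suc i) powr (2 * \<beta>) * real K"
      using \<open>i \<in> {..<K}\<close> by (intro mult_left_mono) auto
    finally have "(\<theta> i)\<^sup>2 * real (Suc i) powr (2 * q) \<le> (\<theta> i)\<^sup>2 * (real (Suc i) powr (2 * \<beta>) * real K)"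
      by (rule mult_left_mono) simp
    then show "(\<theta> i)\<^sup>2 * real (Suc i) powr (2 * q) \<le> (\<theta> i)\<^sup>2 * real (Suc i) powr (2 * \<beta>) * real K"
      by (simp add: mult.assoc)
  qed
  also have "\<dots> = (\<Sum>i<K. (\<theta> i)\<^sup>2 * real (Suc i) powr (2 * \<beta>)) * real K"
    by (simp add: sum_distrib_right)
  also have "\<dots> \<le> L * real K" using sobolev_sum_le[OF \<theta>] by (intro mult_right_mono) auto
  finally show ?thesis .
qed

text \<open>
  \<open>1 - a\<^sub>i = 1 / (1 + t\<^sub>i) \<le> 1 / t\<^sub>i\<close>, which replaces \<open>n\<close> by the inverse prior variance.
\<close>
lemma sobolev_shrinkage_bias:
  assumes \<theta>: "\<theta> \<in> sobolev_class \<beta> L" and q: "2 * q \<le> 2 * \<beta> + 1" and \<tau>0: "\<tau>0 > 0" and n: "n > 0"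
  shows "(\<Sum>i<K. (1 - shrink n (prior_scale \<tau>0 q i)) * (real n * (\<theta> i)\<^sup>2)) \<le> L * real K / \<tau>0"
proof -
  have "(\<Sum>i<K. (1 - shrink n (prior_scale \<tau>0 q i)) * (real n * (\<theta> i)\<^sup>2)) \<le>
      (\<Sum>i<K. (\<theta> i)\<^sup>2 * real (Suc i) powr (2 * q) / \<tau>0)"
  proof (rule sum_mono)
    fix i
    define t where "t = real n * (prior_scale \<tau>0 q i)\<^sup>2"
    have t: "t = real n * \<tau>0 / real (Suc i) powr (2 * q)"
      unfolding t_def prior_scale_sq[OF \<tau>0] by (simp add: powr_minus divide_inverse)
    then have t0: "t > 0" using n \<tau>0 by simp
    have "1 - shrink n (prior_scale \<tau>0 q i) = 1 / (1 + t)"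
      using t0 by (simp add: shrink_def t_def[symmetric] field_simps)
    also have "\<dots> \<le> 1 / t" using t0 by (simp add: field_simps)
    finally have "(1 - shrink n (prior_scale \<tau>0 q i)) * (real n * (\<theta> i)\<^sup>2) \<le> 1 / t * (real n * (\<theta> i)\<^sup>2)"
      by (rule mult_right_mono) simp
    also have "\<dots> = (\<theta> i)\<^sup>2 * real (Suc i) powr (2 * q) / \<tau>0"
      unfolding t using n \<tau>0 by (simp add: field_simps)
    finally show "(1 - shrink n (prior_scale \<tau>0 q i)) * (real n * (\<theta> i)\<^sup>2) \<le>
        (\<theta> i)\<^sup>2 * real (Suc i) powr (2 * q) / \<tau>0" .
  qed
  also have "\<dots> = (\<Sum>i<K. (\<theta> i)\<^sup>2 * real (Suc i) powr (2 * q)) / \<tau>0" by (simp add: sum_divide_distrib)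
  also have "\<dots> \<le> L * real K / \<tau>0"
    using sobolev_prior_sum[OF \<theta> q] \<tau>0 by (intro divide_right_mono) auto
  finally show ?thesis .
qed

lemma fact_le_fact_power:
  assumes "k \<le> l"
  shows "(fact l :: real) \<le> fact k * real l ^ (l - k)"
  using assms
proof (induction l rule: dec_induct)
  case (step l)
  have "(fact (Suc l) :: real) = real (Suc l) * fact l" by simp
  also have "\<dots> \<le> real (Suc l) * (fact k * real l ^ (l - k))"
    using step.IH by (intro mult_left_mono) auto
  also have "\<dots> \<le> real (Suc l) * (fact k * real (Suc l) ^ (l - k))"
    by (intro mult_left_mono power_mono) auto
  also have "\<dots> = fact k * real (Suc l) ^ (Suc l - k)"
    using step.hyps by (simp add: Suc_diff_le)
  finally show ?case .
qed simp

lemma fact_power_le_fact: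
  assumes "l \<le> k"
  shows "fact l * real l ^ (k - l) \<le> (fact k :: real)"
  using assms
proof (induction k rule: dec_induct)
  case (step k)
  have "fact l * real l ^ (Suc k - l) = real l * (fact l * real l ^ (k - l))"
    using step.hyps by (simp add: Suc_diff_le)
  also have "\<dots> \<le> real (Suc k) * fact k"
    using step by (intro mult_mono) auto
  finally show ?case by simp
qed simp

lemma poisson_ratio_le:
  assumes lam: "lam > 0"
  shows "k \<le> l \<Longrightarrow> pmf (poisson_pmf lam) k / pmf (poisson_pmf lam) l \<le> (real l / lam) ^ (l - k)"
    and "0 < l \<Longrightarrow> l \<le> k \<Longrightarrow> pmf (poisson_pmf lam) k / pmf (poisson_pmf lam) l \<le> (lam / real l) ^ (k - l)"
proof -
  have r: "pmf (poisson_pmf lam) k / pmf (poisson_pmf lam) l = lam ^ k * fact l / (lam ^ l * fact k)"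
    using lam by (simp add: field_simps)
  {
    assume kl: "k \<le> l"
    have "lam ^ k * fact l / (lam ^ l * fact k) \<le> lam ^ k * (fact k * real l ^ (l - k)) / (lam ^ l * fact k)"
      using lam fact_le_fact_power[OF kl] by (intro divide_right_mono mult_left_mono) auto
    also have "\<dots> = (real l / lam) ^ (l - k)"
    proof -
      have "lam ^ l = lam ^ k * lam ^ (l - k)" using kl by (simp flip: power_add)
      then show ?thesis using lam by (simp add: power_divide)
    qed
    finally show "pmf (poisson_pmf lam) k / pmf (poisson_pmf lam) l \<le> (real l / lam) ^ (l - k)"
      unfolding r .
  }
  {
    assume l: "0 < l" and lk: "l \<le> k"
    have "lam ^ k * fact l / (lam ^ l * fact k) \<le> lam ^ k * fact l / (lam ^ l * (fact l * real l ^ (k - l)))"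
      using lam l fact_power_le_fact[OF lk] by (intro divide_left_mono mult_left_mono) auto
    also have "\<dots> = (lam / real l) ^ (k - l)"
    proof -
      have "lam ^ k = lam ^ l * lam ^ (k - l)" using lk by (simp flip: power_add)
      then show ?thesis using lam by (simp add: power_divide)
    qed
    finally show "pmf (poisson_pmf lam) k / pmf (poisson_pmf lam) l \<le> (lam / real l) ^ (k - l)"
      unfolding r .
  }
qed

text \<open>
  The Poisson ratio is at most \<open>n ^ (2 l)\<close> and the normalising constants of the Bayes factors at most \<open>n ^ l\<close>; the
  fourth \<open>l log n\<close> in the exponent pays for replacing the factors \<open>a\<^sub>i\<close> by \<open>1\<close>.
\<close>
lemma poisson_underfit_weight:
  assumes \<theta>: "\<theta> \<in> sobolev_class \<beta> L" and q: "0 \<le> q" "2 * q \<le> 2 * \<beta> + 1" and \<tau>0: "\<tau>0 > 0" and lam: "lam > 0"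
    and n: "n > 0" "1 / lam \<le> real n" "1 + real n * \<tau>0 \<le> (real n)\<^sup>2" "L / \<tau>0 \<le> 4 * ln (real n)"
    and l: "l \<le> n" and k: "k \<le> l"
  shows "(\<integral>\<^sup>+\<xi>. dim_weight (poisson_pmf lam) n (prior_scale \<tau>0 q) k (observe n \<theta> \<xi>) \<partial>std_noise) \<le>
    ennreal (exp (4 * (real l * ln (real n)) - real n / 4 * (\<Sum>i\<in>{k..<l}. (\<theta> i)\<^sup>2)))"
proof -
  let ?\<kappa> = "poisson_pmf lam" and ?s = "prior_scale \<tau>0 q"
  let ?b = "\<Sum>i\<in>{k..<l}. (\<theta> i)\<^sup>2"
  have n1: "real n \<ge> 1" using n by simp
  have en: "real n ^ j = exp (real j * ln (real n))" for j
    using n by (simp add: exp_of_nat_mult)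
  have 1: "pmf ?\<kappa> k / pmf ?\<kappa> l \<le> exp (2 * (real l * ln (real n)))"
  proof -
    have "pmf ?\<kappa> k / pmf ?\<kappa> l \<le> (real l * (1 / lam)) ^ (l - k)"
      using poisson_ratio_le(1)[OF lam k] by simp
    also have "\<dots> \<le> (real n * real n) ^ (l - k)"
      using lam l n by (intro power_mono mult_mono) auto
    also have "\<dots> \<le> (real n * real n) ^ l"
      using n1 by (intro power_increasing) (auto simp: mult_ge1_I)
    also have "\<dots> = exp (2 * (real l * ln (real n)))"
      by (simp add: power_mult_distrib en flip: exp_add)
    finally show ?thesis .
  qed
  have 2: "(\<Prod>i\<in>{k..<l}. sqrt (1 + real n * (?s i)\<^sup>2)) \<le> exp (real l * ln (real n))"
  proof -
    have "(\<Prod>i\<in>{k..<l}. sqrt (1 + real n * (?s i)\<^sup>2)) \<le> (\<Prod>i\<in>{k..<l}. real n)"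
    proof (intro prod_mono conjI)
      fix i
      have "real (Suc i) powr (- 2 * q) \<le> real (Suc i) powr 0" using q by (intro powr_mono) auto
      then have "\<tau>0 * real (Suc i) powr (- 2 * q) \<le> \<tau>0 * 1" using \<tau>0 by (intro mult_left_mono) auto
      then have "1 + real n * (?s i)\<^sup>2 \<le> 1 + real n * \<tau>0"
        unfolding prior_scale_sq[OF \<tau>0] by (intro add_left_mono mult_left_mono) auto
      then have "1 + real n * (?s i)\<^sup>2 \<le> (real n)\<^sup>2" using n by linarith
      then show "sqrt (1 + real n * (?s i)\<^sup>2) \<le> real n" by (intro real_le_lsqrt) auto
    qed auto
    also have "\<dots> = real n ^ (l - k)" by simp
    also have "\<dots> \<le> real n ^ l" using n1 by (intro power_increasing) auto
    finally show ?thesis by (simp add: en)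
  qed
  have 3: "(\<Prod>i\<in>{k..<l}. exp (- (shrink n (?s i) * (real n * (\<theta> i)\<^sup>2) / 4))) \<le>
      exp (real l * ln (real n) - real n / 4 * ?b)"
  proof -
    have "(\<Sum>i\<in>{k..<l}. (1 - shrink n (?s i)) * (real n * (\<theta> i)\<^sup>2)) \<le>
        (\<Sum>i<l. (1 - shrink n (?s i)) * (real n * (\<theta> i)\<^sup>2))"
      by (intro sum_mono2 mult_nonneg_nonneg) (auto simp: shrink_def divide_le_eq_1 add_pos_nonneg)
    also have "\<dots> \<le> L * real l / \<tau>0" by (rule sobolev_shrinkage_bias[OF \<theta> q(2) \<tau>0 n(1)])
    also have "\<dots> = L / \<tau>0 * real l" by simp
    also have "\<dots> \<le> 4 * ln (real n) * real l" using n by (intro mult_right_mono) auto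
    finally have "(\<Sum>i\<in>{k..<l}. (1 - shrink n (?s i)) * (real n * (\<theta> i)\<^sup>2)) \<le> 4 * ln (real n) * real l" .
    moreover have "(\<Sum>i\<in>{k..<l}. (1 - shrink n (?s i)) * (real n * (\<theta> i)\<^sup>2)) =
        real n * ?b - (\<Sum>i\<in>{k..<l}. shrink n (?s i) * (real n * (\<theta> i)\<^sup>2))"
      by (simp add: algebra_simps sum_subtractf sum_distrib_left)
    ultimately have "real n * ?b - 4 * ln (real n) * real l \<le>
        (\<Sum>i\<in>{k..<l}. shrink n (?s i) * (real n * (\<theta> i)\<^sup>2))" by linarith
    moreover have "(\<Prod>i\<in>{k..<l}. exp (- (shrink n (?s i) * (real n * (\<theta> i)\<^sup>2) / 4))) =
        exp (- ((\<Sum>i\<in>{k..<l}. shrink n (?s i) * (real n * (\<theta> i)\<^sup>2)) / 4))"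
      by (simp add: exp_sum[symmetric] sum_negf sum_divide_distrib)
    ultimately show ?thesis by (simp add: algebra_simps)
  qed
  have "(\<integral>\<^sup>+\<xi>. dim_weight ?\<kappa> n ?s k (observe n \<theta> \<xi>) \<partial>std_noise) \<le> ennreal (pmf ?\<kappa> k / pmf ?\<kappa> l *
      (\<Prod>i\<in>{k..<l}. sqrt (1 + real n * (?s i)\<^sup>2) * exp (- (shrink n (?s i) * (real n * (\<theta> i)\<^sup>2) / 4))))"
    using lam by (intro underfit_weight n k) simp
  also have "\<dots> \<le> ennreal (exp (2 * (real l * ln (real n))) * (exp (real l * ln (real n)) *
      exp (real l * ln (real n) - real n / 4 * ?b)))"
    unfolding prod.distrib
    by (intro ennreal_leI mult_mono 1 2 3 mult_nonneg_nonneg prod_nonneg) auto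
  also have "\<dots> = ennreal (exp (4 * (real l * ln (real n)) - real n / 4 * ?b))"
    by (simp add: exp_add[symmetric] algebra_simps)
  finally show ?thesis .
qed

text \<open>
  As \<open>l / lam \<ge> n powr \<delta>\<close>, the square root of the Poisson ratio is at most \<open>exp (- (k - l) \<delta> log n / 2)\<close>. For
  \<open>k \<ge> C l\<close> one has \<open>k - l \<ge> k / 2\<close>, and half of this gain absorbs the loss \<open>exp (L l log n / 2)\<close> since
  \<open>L l \<le> \<delta> k / 4\<close>. The rest is \<open>exp (- k \<delta> log n / 8)\<close>.
\<close>
lemma poisson_overfit_weight:
  fixes \<delta> C :: real
  assumes \<theta>: "\<theta> \<in> l2" and lam: "lam > 0" and n: "n > 0" and l: "0 < l" and \<delta>: "\<delta> > 0"
    and bias: "real n * tail_energy l \<theta> \<le> L * (real l * ln (real n))"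
    and growth: "real n powr \<delta> \<le> real l / lam"
    and C: "2 \<le> C" "4 * L / \<delta> \<le> C" and ln_n: "8 * ln 16 \<le> \<delta> * ln (real n)"
    and k: "C * real l \<le> real k"
  shows "(\<integral>\<^sup>+\<xi>. dim_weight (poisson_pmf lam) n s k (observe n \<theta> \<xi>) \<partial>std_noise) \<le> ennreal ((1/16) ^ k)"
proof -
  let ?\<kappa> = "poisson_pmf lam"
  have ln0: "ln (real n) \<ge> 0" using n by simp
  have "2 * real l \<le> C * real l" using C by (intro mult_right_mono) auto
  with k have k2: "2 * real l \<le> real k" by linarith
  then have lk: "l \<le> k" by linarith
  have 1: "sqrt (pmf ?\<kappa> k / pmf ?\<kappa> l) \<le> exp (- (real (k - l) * (\<delta> * ln (real n)) / 2))"
  proof (rule real_le_lsqrt)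
    have "pmf ?\<kappa> k / pmf ?\<kappa> l \<le> (lam / real l) ^ (k - l)" by (rule poisson_ratio_le(2)[OF lam l lk])
    also have "\<dots> \<le> exp (- (\<delta> * ln (real n))) ^ (k - l)"
    proof (rule power_mono)
      have "exp (\<delta> * ln (real n)) \<le> real l / lam" using growth n by (simp add: powr_def)
      then show "lam / real l \<le> exp (- (\<delta> * ln (real n)))"
        using lam l by (simp add: exp_minus field_simps)
    qed (use lam in auto)
    also have "\<dots> = (exp (- (real (k - l) * (\<delta> * ln (real n)) / 2)))\<^sup>2"
      by (simp flip: exp_of_nat_mult)
    finally show "pmf ?\<kappa> k / pmf ?\<kappa> l \<le> (exp (- (real (k - l) * (\<delta> * ln (real n)) / 2)))\<^sup>2" .
  qed auto
  have 2: "real n * (\<Sum>i\<in>{l..<k}. (\<theta> i)\<^sup>2) / 2 \<le> L * (real l * ln (real n)) / 2"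
  proof -
    have "(\<Sum>i\<in>{l..<k}. (\<theta> i)\<^sup>2) \<le> tail_energy l \<theta>"
      using tail_energy_split[OF \<theta> lk] tail_energy_nonneg[OF \<theta>, of k] by simp
    then have "real n * (\<Sum>i\<in>{l..<k}. (\<theta> i)\<^sup>2) \<le> real n * tail_energy l \<theta>" by (intro mult_left_mono) auto
    then show ?thesis using bias by linarith
  qed
  have 3: "L * (real l * ln (real n)) / 2 - real (k - l) * (\<delta> * ln (real n)) / 2 \<le> - (real k * ln 16)"
  proof -
    have "4 * L \<le> \<delta> * C" using C(2) \<delta> by (simp add: field_simps)
    then have "4 * L * real l \<le> \<delta> * C * real l" by (intro mult_right_mono) auto
    also have "\<dots> \<le> \<delta> * real k" using k \<delta> by (simp add: mult.assoc)
    finally have "4 * L * real l * ln (real n) \<le> \<delta> * real k * ln (real n)" using ln0 by (intro mult_right_mono)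
    moreover have "real k / 2 * (\<delta> * ln (real n)) \<le> real (k - l) * (\<delta> * ln (real n))"
      using k2 lk \<delta> ln0 by (intro mult_right_mono) (auto simp: of_nat_diff)
    moreover have "real k * (8 * ln 16) \<le> real k * (\<delta> * ln (real n))"
      using ln_n by (intro mult_left_mono) auto
    ultimately show ?thesis by (simp add: algebra_simps)
  qed
  have "(\<integral>\<^sup>+\<xi>. dim_weight ?\<kappa> n s k (observe n \<theta> \<xi>) \<partial>std_noise) \<le>
    ennreal (sqrt (pmf ?\<kappa> k / pmf ?\<kappa> l) * exp (real n * (\<Sum>i\<in>{l..<k}. (\<theta> i)\<^sup>2) / 2))"
    using lam by (intro overfit_weight n lk) simp
  also have "\<dots> \<le> ennreal (exp (- (real (k - l) * (\<delta> * ln (real n)) / 2)) * exp (L * (real l * ln (real n)) / 2))"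
    using 2 by (intro ennreal_leI mult_mono 1) auto
  also have "\<dots> \<le> ennreal (exp (- (real k * ln 16)))"
    using 3 by (intro ennreal_leI) (simp flip: exp_add)
  also have "exp (- (real k * ln 16)) = (1/16) ^ k"
    by (simp add: exp_minus exp_of_nat_mult power_one_over)
       (simp add: inverse_eq_divide)
  finally show ?thesis .
qed

section \<open>The rate of convergence\<close>

text \<open>
  The tolerance is \<open>A = 32 l log n / n\<close>: beyond it the term \<open>4 l log n\<close> in \<open>poisson_underfit_weight\<close> is at most half
  of \<open>n b / 4\<close>.
\<close>
lemma poisson_sieve_risk_le:
  fixes C l n :: nat and \<delta> \<rho> :: real
  assumes p: "wn_densities n \<mu> p"
    and \<theta>: "\<theta> \<in> sobolev_class \<beta> L" and \<beta>: "\<beta> > 0" and q: "0 \<le> q" "2 * q \<le> 2 * \<beta> + 1"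
    and \<tau>0: "\<tau>0 > 0" and lam: "lam > 0" and L: "L \<ge> 0"
    and n: "n > 0" "1 / lam \<le> real n" "1 + real n * \<tau>0 \<le> (real n)\<^sup>2" "L / \<tau>0 \<le> 4 * ln (real n)" "1 \<le> ln (real n)"
    and \<delta>: "\<delta> > 0" "8 * ln 16 \<le> \<delta> * ln (real n)"
    and C: "2 \<le> C" "4 * L / \<delta> \<le> real C"
    and l: "0 < l" "l \<le> n" "real n powr \<delta> \<le> real l / lam" "real l * ln (real n) \<le> 2 * (real n * \<rho>)"
    and tail: "tail_energy l \<theta> \<le> L * \<rho>" "real n * tail_energy l \<theta> \<le> L * (real l * ln (real n))"
  shows "posterior_risk (sieve_prior lam \<tau>0 q) n p \<theta> \<le>
    ennreal ((2 * (2 * L * real C / \<tau>0 + 3 * real C + 44) + 3 * L + 64) * \<rho>)"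
proof -
  let ?s = "prior_scale \<tau>0 q" and ?\<kappa> = "poisson_pmf lam"
  define A where "A = 32 * (real l * ln (real n)) / real n"
  have l2: "\<theta> \<in> l2" by (rule sobolev_class_l2[OF \<theta> \<beta>])
  have A: "A \<ge> 0" using n by (simp add: A_def)
  have K: "l \<le> C * l" using C by simp
  have prior: "sieve_prior lam \<tau>0 q =
      distr (measure_pmf ?\<kappa> \<Otimes>\<^sub>M std_noise) seq_borel (\<lambda>(k, z). sieve_draw ?s k z)"
    by (simp add: sieve_prior_def sieve_draw_def)
  have "posterior_risk (sieve_prior lam \<tau>0 q) n p \<theta> \<le>
    (\<integral>\<^sup>+x. (\<Sum>k. dim_weight ?\<kappa> n ?s k x *
       ennreal ((\<Sum>i<k. coord_risk n (?s i) (\<theta> i) (x i)) + tail_energy k \<theta>)) \<partial>wn_law n \<theta>)"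
    by (rule posterior_risk_le[OF p n(1) l2 prior])
  also have "\<dots> \<le> ennreal ((\<Sum>i<C * l. 2 * (1 - shrink n (?s i)) * (\<theta> i)\<^sup>2) + 3 * tail_energy l \<theta> + A +
       (3 * real (C * l) + 8 * real l + 36) / real n)"
  proof (rule sieve_risk_bound[OF n(1) l2 K A])
    fix k assume k: "k < l" and b: "A < (\<Sum>i\<in>{k..<l}. (\<theta> i)\<^sup>2)"
    let ?b = "\<Sum>i\<in>{k..<l}. (\<theta> i)\<^sup>2"
    have "(\<integral>\<^sup>+\<xi>. dim_weight ?\<kappa> n ?s k (observe n \<theta> \<xi>) \<partial>std_noise) \<le>
        ennreal (exp (4 * (real l * ln (real n)) - real n / 4 * ?b))"
      using k by (intro poisson_underfit_weight[OF \<theta> q \<tau>0 lam n(1-4) l(2)]) auto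
    also have "4 * (real l * ln (real n)) - real n / 4 * ?b \<le> - (real n / 8 * ?b)"
    proof -
      have "real n * A \<le> real n * ?b" using b by (intro mult_left_mono) auto
      then show ?thesis using n by (simp add: A_def)
    qed
    then have "ennreal (exp (4 * (real l * ln (real n)) - real n / 4 * ?b)) \<le>
        ennreal (exp (- (real n / 8 * ?b)))"
      by (intro ennreal_leI) simp
    finally show "(\<integral>\<^sup>+\<xi>. dim_weight ?\<kappa> n ?s k (observe n \<theta> \<xi>) \<partial>std_noise) \<le>
        ennreal (exp (- (real n / 8 * ?b)))" .
  next
    fix k assume "C * l < k"
    then have k: "real C * real l \<le> real k" by (metis less_imp_le of_nat_le_iff of_nat_mult)
    show "(\<integral>\<^sup>+\<xi>. dim_weight ?\<kappa> n ?s k (observe n \<theta> \<xi>) \<partial>std_noise) \<le> ennreal ((1/16) ^ k)"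
      using C by (intro poisson_overfit_weight[OF l2 lam n(1) l(1) \<delta>(1) tail(2) l(3) _ C(2) \<delta>(2) k]) simp
  qed
  also have "\<dots> \<le> ennreal ((2 * (2 * L * real C / \<tau>0 + 3 * real C + 44) + 3 * L + 64) * \<rho>)"
  proof (rule ennreal_leI)
    have shr: "(\<Sum>i<C * l. 2 * (1 - shrink n (?s i)) * (\<theta> i)\<^sup>2) \<le> 2 * L * real C / \<tau>0 * (real l / real n)"
    proof -
      have "(\<Sum>i<C * l. 2 * (1 - shrink n (?s i)) * (\<theta> i)\<^sup>2) =
          2 / real n * (\<Sum>i<C * l. (1 - shrink n (?s i)) * (real n * (\<theta> i)\<^sup>2))"
        unfolding sum_distrib_left using n by (intro sum.cong) auto
      also have "\<dots> \<le> 2 / real n * (L * real (C * l) / \<tau>0)"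
        by (intro mult_left_mono sobolev_shrinkage_bias[OF \<theta> q(2) \<tau>0 n(1)]) auto
      finally show ?thesis by (simp add: mult_ac)
    qed
    have An: "A \<le> 64 * \<rho>" using l(4) n by (simp add: A_def field_simps)
    have ln2: "real l / real n \<le> 2 * \<rho>"
    proof -
      have "real l * 1 \<le> real l * ln (real n)" using n by (intro mult_left_mono) auto
      then have "real l \<le> 2 * (real n * \<rho>)" using l(4) by linarith
      then show ?thesis using n by (simp add: field_simps)
    qed
    have "(3 * real (C * l) + 8 * real l + 36) / real n \<le> (3 * real C * real l + 8 * real l + 36 * real l) / real n"
      using l(1) by (intro divide_right_mono) auto
    also have "\<dots> = (3 * real C + 44) * (real l / real n)" by (simp add: field_simps)
    finally have "(\<Sum>i<C * l. 2 * (1 - shrink n (?s i)) * (\<theta> i)\<^sup>2) + (3 * real (C * l) + 8 * real l + 36) / real n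
        \<le> (2 * L * real C / \<tau>0 + 3 * real C + 44) * (real l / real n)"
      using shr by (simp add: algebra_simps)
    also have "\<dots> \<le> (2 * L * real C / \<tau>0 + 3 * real C + 44) * (2 * \<rho>)"
      using ln2 L \<tau>0 by (intro mult_left_mono) (auto intro!: add_nonneg_nonneg)
    finally have "(\<Sum>i<C * l. 2 * (1 - shrink n (?s i)) * (\<theta> i)\<^sup>2) + (3 * real (C * l) + 8 * real l + 36) / real n
        \<le> 2 * (2 * L * real C / \<tau>0 + 3 * real C + 44) * \<rho>" by (simp add: mult_ac)
    moreover have "3 * tail_energy l \<theta> \<le> 3 * L * \<rho>" using tail(1) by simp
    ultimately show "(\<Sum>i<C * l. 2 * (1 - shrink n (?s i)) * (\<theta> i)\<^sup>2) + 3 * tail_energy l \<theta> + A +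
       (3 * real (C * l) + 8 * real l + 36) / real n \<le>
       (2 * (2 * L * real C / \<tau>0 + 3 * real C + 44) + 3 * L + 64) * \<rho>"
      using An unfolding distrib_right[of _ _ \<rho>] by linarith
  qed
  finally show ?thesis .
qed

text \<open>
  The dimension that balances the complexity cost \<open>l log n / n\<close> with the squared bias \<open>l powr (- 2 * \<beta>)\<close>.
\<close>
definition oracle_dim :: "real \<Rightarrow> nat \<Rightarrow> nat" where
  "oracle_dim \<beta> n = nat \<lceil>(real n / ln (real n)) powr (1 / (2 * \<beta> + 1))\<rceil>"

text \<open>
  With \<open>y = (n / log n) powr (1 / (2 \<beta> + 1))\<close> one has exactly \<open>y powr (- 2 \<beta>) = \<rho>\<close> and \<open>y log n = n \<rho>\<close>; rounding \<open>y\<close> up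
  to an integer at most doubles it, as \<open>y \<ge> 1\<close>.
\<close>
lemma oracle_dim_balance:
  fixes n :: nat
  assumes \<beta>: "\<beta> > 0" and n: "2 \<le> ln (real n)"
  defines "l \<equiv> oracle_dim \<beta> n" and "\<rho> \<equiv> (rate 1 \<beta> n)\<^sup>2"
  shows "(real n / ln (real n)) powr (1 / (2 * \<beta> + 1)) \<le> real l"
    and "0 < l" and "l \<le> n"
    and "real l * ln (real n) \<le> 2 * (real n * \<rho>)"
    and "real n * \<rho> \<le> real l * ln (real n)"
    and "real l powr (- 2 * \<beta>) \<le> \<rho>"
proof -
  define r where "r = real n / ln (real n)"
  define y where "y = r powr (1 / (2 * \<beta> + 1))"
  have n0: "real n > 0" using n by (cases n) auto
  have "ln (real n) \<le> real n - 1" using n0 by (rule ln_le_minus_one)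
  then have r1: "r \<ge> 1" using n by (simp add: r_def)
  have y1: "y \<ge> 1" unfolding y_def using r1 \<beta> by (intro ge_one_powr_ge_zero) auto
  show yl: "y \<le> real l" unfolding l_def oracle_dim_def y_def r_def by linarith
  then show "0 < l" using y1 by simp
  have l1: "real l \<le> y + 1" using y1 unfolding l_def oracle_dim_def y_def r_def by linarith
  then have ly: "real l \<le> 2 * y" using y1 by linarith
  have "y \<le> r powr 1" unfolding y_def using r1 \<beta> by (intro powr_mono) auto
  then have "2 * y \<le> 2 * r" using r1 by simp
  also have "2 * r \<le> real n"
    using mult_left_mono[OF n, of "real n"] n by (simp add: r_def pos_divide_le_eq mult.commute)
  finally show "l \<le> n" using ly by linarith
  have \<rho>: "\<rho> = r powr (- (2 * \<beta> / (2 * \<beta> + 1)))"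
  proof -
    have "(ln (real n) / real n) = r powr (- 1)" using n n0 by (simp add: r_def powr_minus_divide)
    then have "\<rho> = (r powr (- 1 * (\<beta> / (2 * \<beta> + 1))))\<^sup>2"
      unfolding \<rho>_def rate_def by (simp only: powr_powr mult_1)
    also have "\<dots> = r powr (- (2 * \<beta> / (2 * \<beta> + 1)))"
      by (simp add: power2_eq_square flip: powr_add)
    finally show ?thesis .
  qed
  have "1 / (2 * \<beta> + 1) = 1 + - (2 * \<beta> / (2 * \<beta> + 1))" using \<beta> by (simp add: field_simps)
  then have "y = r powr 1 * \<rho>" unfolding y_def \<rho> powr_add[symmetric] by simp
  then have y\<rho>: "y * ln (real n) = real n * \<rho>" using r1 n by (simp add: r_def)
  show "real l * ln (real n) \<le> 2 * (real n * \<rho>)"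
  proof -
    have "real l * ln (real n) \<le> 2 * y * ln (real n)" using ly n by (intro mult_right_mono) auto
    then show ?thesis by (simp add: mult.assoc y\<rho>)
  qed
  show "real n * \<rho> \<le> real l * ln (real n)"
    using mult_right_mono[OF yl, of "ln (real n)"] n y\<rho> by simp
  have "real l powr (- 2 * \<beta>) \<le> y powr (- 2 * \<beta>)"
    using yl y1 \<beta> by (intro powr_mono2') auto
  also have "\<dots> = \<rho>" unfolding y_def \<rho> by (simp add: powr_powr)
  finally show "real l powr (- 2 * \<beta>) \<le> \<rho>" .
qed

text \<open>
  The dimension grows polynomially; this is what makes the Poisson prior decay like \<open>exp (- c k log n)\<close> above it.
\<close>
lemma eventually_powr_le_oracle_dim:
  assumes a: "a > (0::real)" and lam: "lam > 0"
  shows "\<forall>\<^sub>F n in sequentially. real n powr (a / 2) * lam \<le> (real n / ln (real n)) powr a"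
proof -
  have "((\<lambda>x::real. x powr (a / 2) * lam / (x / ln x) powr a) \<longlongrightarrow> 0) at_top"
    using a by real_asymp
  then have "\<forall>\<^sub>F x in at_top. \<bar>x powr (a / 2) * lam / (x / ln x) powr a\<bar> < 1"
    by (auto dest!: tendstoD[where e=1] simp: dist_real_def)
  moreover have "\<forall>\<^sub>F x::real in at_top. x > exp 1" by (rule eventually_gt_at_top)
  ultimately have "\<forall>\<^sub>F x in at_top. x powr (a / 2) * lam \<le> (x / ln x) powr a"
  proof eventually_elim
    case (elim x)
    then have x: "x > 0" using exp_gt_zero[of "1::real"] by linarith
    then have "ln x > 1" using elim(2) by (metis exp_less_cancel_iff exp_ln)
    then have "x / ln x > 0" using x by (intro divide_pos_pos; linarith)
    then have "(x / ln x) powr a > 0" by (metis less_irrefl powr_gt_zero)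
    then show ?case using elim(1) lam x by (simp add: abs_mult divide_less_eq split: if_splits)
  qed
  then show ?thesis by (rule eventually_compose_filterlim[OF _ filterlim_real_sequentially])
qed

theorem proposition3:
  fixes lam \<tau>0 q L0 \<beta>1 \<beta>2 :: real
    and \<mu> :: "nat \<Rightarrow> (nat \<Rightarrow> real) measure"
    and p :: "nat \<Rightarrow> (nat \<Rightarrow> real) \<Rightarrow> (nat \<Rightarrow> real) \<Rightarrow> real"
  assumes "lam > 0" and "\<tau>0 > 0" and "1/2 < q" and "q \<le> 1"
    and "L0 > 0" and "1/2 < \<beta>1" and "\<beta>1 \<le> \<beta>2"
    and "\<And>n. n \<ge> 1 \<Longrightarrow> wn_densities n (\<mu> n) (p n)"
  shows "\<exists>\<epsilon>0>0. \<forall>j0>0.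
    (\<exists>m\<ge>5. \<exists>C0>0. \<forall>\<^sub>F n in sequentially. \<forall>\<beta>\<in>{\<beta>1..\<beta>2}. \<forall>\<theta>0\<in>sobolev_class \<beta> L0.
       let \<theta>0j = first_coords (cutoff j0 \<epsilon>0 \<beta> n) \<theta>0 in
         K_div (\<mu> n) (p n \<theta>0) (p n \<theta>0j) \<le> C0 * real n * (l2_norm (\<theta>0 - \<theta>0j))\<^sup>2 \<and>
         V_div (\<mu> n) m (p n \<theta>0) (p n \<theta>0j)
           \<le> ennreal (C0 powr m * real n powr (m / 2) * l2_norm (\<theta>0 - \<theta>0j) powr m))
    \<longrightarrow>
    (\<forall>\<beta>\<in>{\<beta>1..\<beta>2}. \<forall>\<theta>0\<in>sobolev_class \<beta> L0.
       (\<forall>\<^sub>F n in sequentially. posterior_risk (sieve_prior lam \<tau>0 q) n (p n) \<theta>0 < \<top>) \<and>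
       (\<lambda>n. enn2real (posterior_risk (sieve_prior lam \<tau>0 q) n (p n) \<theta>0))
         \<in> O(\<lambda>n. (rate \<epsilon>0 \<beta> n)\<^sup>2))"
proof (intro exI[of _ "1::real"] conjI allI impI ballI)
  fix \<beta> \<theta>0 assume "\<beta> \<in> {\<beta>1..\<beta>2}" and \<theta>0: "\<theta>0 \<in> sobolev_class \<beta> L0"
  then have \<beta>: "\<beta> > 1/2" using assms by auto
  \<comment> \<open>Half the polynomial growth exponent of the oracle dimension, which leaves room for \<open>lam\<close> and \<open>log n\<close>.\<close>
  define \<delta> where "\<delta> = 1 / (2 * \<beta> + 1) / 2"
  have \<delta>: "\<delta> > 0" using \<beta> by (simp add: \<delta>_def)
  define C where "C = max 2 (nat \<lceil>4 * L0 / \<delta>\<rceil>)"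
  have C: "2 \<le> C" "4 * L0 / \<delta> \<le> real C" unfolding C_def by linarith+
  define M where "M = 2 * (2 * L0 * real C / \<tau>0 + 3 * real C + 44) + 3 * L0 + 64"
  have ln_large: "\<forall>\<^sub>F n in sequentially. c \<le> ln (real n)" for c :: real
    by real_asymp
  have quad: "\<forall>\<^sub>F n in sequentially. 1 + real n * \<tau>0 \<le> (real n)\<^sup>2"
    by real_asymp
  have lin: "\<forall>\<^sub>F n in sequentially. 1 / lam \<le> real n"
    by real_asymp
  have "1 / (2 * \<beta> + 1) > 0" using \<beta> by simp
  note powr = eventually_powr_le_oracle_dim[OF this \<open>lam > 0\<close>]
  have bound: "\<forall>\<^sub>F n in sequentially. posterior_risk (sieve_prior lam \<tau>0 q) n (p n) \<theta>0 \<le> ennreal (M * (rate 1 \<beta> n)\<^sup>2)"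
    using ln_large[of 2] ln_large[of "L0 / \<tau>0 / 4"] ln_large[of "8 * ln 16 / \<delta>"] quad lin powr eventually_gt_at_top[of 0]
  proof eventually_elim
    case (elim n)
    have \<beta>0: "\<beta> > 0" using \<beta> by simp
    note bal = oracle_dim_balance[OF \<beta>0 elim(1)]
    have tail: "tail_energy (oracle_dim \<beta> n) \<theta>0 \<le> L0 * (rate 1 \<beta> n)\<^sup>2"
    proof -
      have "tail_energy (oracle_dim \<beta> n) \<theta>0 \<le> L0 * real (oracle_dim \<beta> n) powr (- 2 * \<beta>)"
        using bal(2) by (intro sobolev_tail_energy[OF \<theta>0 \<beta>0]) simp
      also have "\<dots> \<le> L0 * (rate 1 \<beta> n)\<^sup>2"
        using bal(6) assms by (intro mult_left_mono) auto
      finally show ?thesis .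
    qed
    have ntail: "real n * tail_energy (oracle_dim \<beta> n) \<theta>0 \<le> L0 * (real (oracle_dim \<beta> n) * ln (real n))"
    proof -
      have "real n * tail_energy (oracle_dim \<beta> n) \<theta>0 \<le> L0 * (real n * (rate 1 \<beta> n)\<^sup>2)"
        using mult_left_mono[OF tail, of "real n"] by (simp add: mult_ac)
      also have "\<dots> \<le> L0 * (real (oracle_dim \<beta> n) * ln (real n))"
        using bal(5) assms by (intro mult_left_mono) auto
      finally show ?thesis .
    qed
    have "real n powr \<delta> * lam \<le> real (oracle_dim \<beta> n)"
      using elim(6) bal(1) unfolding \<delta>_def by linarith
    then have growth: "real n powr \<delta> \<le> real (oracle_dim \<beta> n) / lam"
      using assms(1) by (simp add: field_simps)
    show ?case
      unfolding M_def
      by (rule poisson_sieve_risk_le[where \<beta>=\<beta> and l="oracle_dim \<beta> n" and \<delta>=\<delta> and \<mu>="\<mu> n"])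
         (use assms elim \<beta> \<delta> C bal \<theta>0 tail ntail growth in \<open>auto simp: field_simps\<close>)
  qed
  show "\<forall>\<^sub>F n in sequentially. posterior_risk (sieve_prior lam \<tau>0 q) n (p n) \<theta>0 < \<top>"
    using bound by eventually_elim (auto simp: le_less_trans[OF _ ennreal_less_top])
  show "(\<lambda>n. enn2real (posterior_risk (sieve_prior lam \<tau>0 q) n (p n) \<theta>0)) \<in> O(\<lambda>n. (rate 1 \<beta> n)\<^sup>2)"
  proof (rule bigoI[of _ M])
    have "M \<ge> 0" unfolding M_def using assms by (auto intro!: add_nonneg_nonneg mult_nonneg_nonneg divide_nonneg_nonneg)
    show "\<forall>\<^sub>F n in sequentially. norm (enn2real (posterior_risk (sieve_prior lam \<tau>0 q) n (p n) \<theta>0))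
        \<le> M * norm ((rate 1 \<beta> n)\<^sup>2)"
      using bound by eventually_elim (use \<open>M \<ge> 0\<close> in \<open>simp add: enn2real_leI\<close>)
  qed
qed simp

end
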